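(* Let $f:[a,b]\to[a,b]$ be an S-unimodal map with at least two nodes. Then the special $\alpha$-limit set $s\alpha_f(x)$ is closed for every $x\in[a,b]$.
   Context: A $C^3$ map $f:[a,b]\to[a,b]$ is S-unimodal if $f(a)=f(b)=a$, $f$ has a unique critical point $c\in(a,b)$, which is a maximum, and the Schwarzian derivative $Sf=\frac{f'''}{f'}-\frac32\left(\frac{f''}{f'}\right)^2$ is negative for all $x\ne c$. A bitrajectory based at $x$ is a sequence $t=(t_i)_{i\in\mathbb Z}$ with $t_0=x$ and $f(t_i)=t_{i+1}$ for all $i$; $\alpha(t)$ is the set of limit points of $t_n$ as $n\to-\infty$. The special $\alpha$-limit is $s\alpha_f(x)=\bigcup\alpha(t)$ over all bitrajectories $t$ based at $x$ (empty if there are none). An $\epsilon$-chain from $x$ to $y$ is a sequence $x_0=x,x_1,\dots,x_{n+1}=y$ with $|f(x_i)-x_{i+1}|<\epsilon$ for $i=0,\dots,n$. A point is chain-recurrent if for every $\epsilon>0$ there is an $\epsilon$-chain from it to itself. On the set of chain-recurrent points, $x\sim y$ if for every $\epsilon>0$ there are $\epsilon$-chains from $x$ to $y$ and from $y$ to $x$; the equivalence classes are called nodes. *)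

theory Defs
  imports "HOL-Analysis.Analysis"
begin

section \<open>S-unimodal maps\<close>

text \<open>Maps of an interval \<open>{a..b}\<close> are total functions \<open>real \<Rightarrow> real\<close> whose values
  outside the interval are irrelevant. Derivatives are therefore taken within the interval,
  i.e. they are one-sided at the endpoints.\<close>

definition nderiv_on :: "real set \<Rightarrow> nat \<Rightarrow> (real \<Rightarrow> real) \<Rightarrow> real \<Rightarrow> real" where
  "nderiv_on S k f = ((\<lambda>g x. vector_derivative g (at x within S)) ^^ k) f"

definition Ck_on :: "real set \<Rightarrow> nat \<Rightarrow> (real \<Rightarrow> real) \<Rightarrow> bool" where
  "Ck_on S k f \<longleftrightarrow>
     (\<forall>j<k. nderiv_on S j f differentiable_on S) \<and> continuous_on S (nderiv_on S k f)"

definition schwarzian_on :: "real set \<Rightarrow> (real \<Rightarrow> real) \<Rightarrow> real \<Rightarrow> real" where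
  "schwarzian_on S f x =
     nderiv_on S 3 f x / nderiv_on S 1 f x
     - 3 / 2 * (nderiv_on S 2 f x / nderiv_on S 1 f x)^2"

text \<open>The critical point is unique in the whole closed interval, so the Schwarzian derivative
  below is never evaluated where \<open>f'\<close> vanishes (where it would be subject to \<open>x / 0 = 0\<close>).\<close>

definition S_unimodal :: "real \<Rightarrow> real \<Rightarrow> (real \<Rightarrow> real) \<Rightarrow> bool" where
  "S_unimodal a b f \<longleftrightarrow>
     a < b \<and> f ` {a..b} \<subseteq> {a..b} \<and> Ck_on {a..b} 3 f \<and> f a = a \<and> f b = a \<and>
     (\<exists>c\<in>{a<..<b}.
        {x\<in>{a..b}. nderiv_on {a..b} 1 f x = 0} = {c} \<and>
        (\<forall>x\<in>{a..b}. f x \<le> f c) \<and>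
        (\<forall>x\<in>{a..b} - {c}. schwarzian_on {a..b} f x < 0))"

section \<open>Special alpha-limit sets\<close>

definition bitrajectory :: "real set \<Rightarrow> (real \<Rightarrow> real) \<Rightarrow> real \<Rightarrow> (int \<Rightarrow> real) \<Rightarrow> bool" where
  "bitrajectory X f x t \<longleftrightarrow> (\<forall>i. t i \<in> X) \<and> t 0 = x \<and> (\<forall>i. f (t i) = t (i + 1))"

text \<open>Limit points are those of the sequence, not accumulation points of its range: a constant
  bitrajectory has a nonempty \<open>\<alpha>\<close>-limit.\<close>

definition alpha_limit :: "(int \<Rightarrow> real) \<Rightarrow> real set" where
  "alpha_limit t = {y. \<exists>r :: nat \<Rightarrow> nat. strict_mono r \<and> (\<lambda>k. t (- int (r k))) \<longlonglongrightarrow> y}"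

definition special_alpha_limit :: "real set \<Rightarrow> (real \<Rightarrow> real) \<Rightarrow> real \<Rightarrow> real set" where
  "special_alpha_limit X f x = (\<Union>t\<in>{t. bitrajectory X f x t}. alpha_limit t)"

section \<open>Chain recurrence and nodes\<close>

text \<open>A chain from \<open>p\<close> to \<open>q\<close> has at least one step, so chain recurrence is not trivial.\<close>

definition eps_chain :: "real set \<Rightarrow> (real \<Rightarrow> real) \<Rightarrow> real \<Rightarrow> real \<Rightarrow> real \<Rightarrow> bool" where
  "eps_chain X f \<epsilon> p q \<longleftrightarrow>
     (\<exists>n. \<exists>x :: nat \<Rightarrow> real. x 0 = p \<and> x (n + 1) = q \<and> (\<forall>i\<le>n + 1. x i \<in> X) \<and>
        (\<forall>i\<le>n. \<bar>f (x i) - x (i + 1)\<bar> < \<epsilon>))"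

definition chain_recurrent :: "real set \<Rightarrow> (real \<Rightarrow> real) \<Rightarrow> real set" where
  "chain_recurrent X f = {x\<in>X. \<forall>\<epsilon>>0. eps_chain X f \<epsilon> x x}"

definition chain_equiv :: "real set \<Rightarrow> (real \<Rightarrow> real) \<Rightarrow> (real \<times> real) set" where
  "chain_equiv X f =
     {(x, y). x \<in> chain_recurrent X f \<and> y \<in> chain_recurrent X f \<and>
        (\<forall>\<epsilon>>0. eps_chain X f \<epsilon> x y \<and> eps_chain X f \<epsilon> y x)}"

definition nodes :: "real set \<Rightarrow> (real \<Rightarrow> real) \<Rightarrow> real set set" where
  "nodes X f = chain_recurrent X f // chain_equiv X f"

end

theory Submission
  imports Defs
begin

text \<open>The argument uses only that \<open>f\<close> has a single turning point \<open>c\<close>, that \<open>f'\<close> vanishes nowhere else, and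
that \<open>f'\<close> is Lipschitz. A point lies in the special \<open>\<alpha>\<close>-limit of \<open>x\<close> iff some backward orbit
of \<open>x\<close> clusters there. Let \<open>y\<close> be a limit of such points; conjugating by \<open>x \<mapsto> - x\<close> if necessary,
let them approach \<open>y\<close> from the left, and suppose that no backward orbit of \<open>x\<close> clusters at \<open>y\<close>.

Let \<open>U e\<close> be the left neighbourhood \<open>(y - e, y)\<close>, let \<open>M e\<close> be the union of its forward images, and
let \<open>K e\<close> be the component of \<open>M e\<close> containing \<open>U e\<close>. As backward orbits of \<open>x\<close> return to \<open>U e\<close>,
\<open>K e\<close> is a periodic interval: some iterate \<open>f\<^sup>p\<close>, with \<open>p = per e\<close>, maps it into itself, while
images of \<open>K e\<close> whose times differ modulo \<open>p\<close> are disjoint. Were some \<open>U \<delta>\<close> contained in all \<open>M e\<close>,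
one could jump backwards to points ever closer to \<open>y\<close> (\<open>M_not_absorbing\<close>); hence the left endpoint
of \<open>K e\<close> tends to \<open>y\<close>. The map \<open>f\<^sup>p\<close> on \<open>K e\<close> is monotone or has one turning point. If it is monotone,
or if the periods \<open>per e\<close> stay bounded, then the cluster points of backward orbits close to \<open>y\<close> are
fixed by an increasing iterate (or have no preimages nearby, which is absurd). The gaps between them are invariant under this iterate, so \<open>x\<close> cannot be
reached from several gaps (\<open>no_monotone_returns\<close>, \<open>c_in_M\<close>, \<open>period_unbounded\<close>).

There remains the infinitely renormalizable case, in which \<open>per e\<close> is unbounded. As \<open>f\<close> is at most
two-to-one, \<open>x\<close> has a backward orbit that stays in every \<open>M e\<close>, and it visits every image of every \<open>K e\<close>.
Since it does not cluster at \<open>y\<close>, the interval \<open>K e\<close> is the leftmost among its images inside a fixed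
\<open>K e1\<close>, and it does not shrink to \<open>y\<close>. The leftmost interval contains the first or second image of the turning
point of the return map of \<open>K e1\<close>, which is a point \<open>f\<^sup>S c\<close> with \<open>S\<close> independent of \<open>e\<close>.
Pulling back by \<open>f\<^sup>S\<close> gives nested periodic intervals around \<open>c\<close>, of unbounded period, that do not
shrink to \<open>c\<close>. This is impossible by a Denjoy-type argument (\<open>no_wandering_turning_interval\<close>):
the images of their intersection are disjoint and, from the first image on, stay away from \<open>c\<close>, so that all iterates have bounded distortion near it, and a neighbourhood of one of its images is
mapped into itself and contracted to a periodic orbit. No nonflatness of \<open>f\<close> at \<open>c\<close> is needed,
since a wandering interval around \<open>c\<close> keeps its own orbit away from \<open>c\<close>.\<close>

section \<open>Backward orbits\<close>

text \<open>The negative half of a bitrajectory, indexed by \<open>n \<ge> 0\<close>: \<open>s n\<close> is an \<open>n\<close>-th preimage of \<open>x\<close>.\<close>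

definition backward_orbit :: "real set \<Rightarrow> (real \<Rightarrow> real) \<Rightarrow> real \<Rightarrow> (nat \<Rightarrow> real) \<Rightarrow> bool" where
  "backward_orbit X f x s \<longleftrightarrow> s 0 = x \<and> (\<forall>n. s n \<in> X \<and> f (s (Suc n)) = s n)"

text \<open>Some subsequence converges to \<open>y\<close>; the sequence may also take the value \<open>y\<close> infinitely often.\<close>

definition clusters_at :: "(nat \<Rightarrow> real) \<Rightarrow> real \<Rightarrow> bool" where
  "clusters_at s y \<longleftrightarrow> (\<forall>\<eta>>0. \<forall>N. \<exists>n\<ge>N. \<bar>s n - y\<bar> < \<eta>)"

lemma backward_orbit_iter:
  assumes "backward_orbit X f x s"
  shows "(f ^^ k) (s (n + k)) = s n"
proof (induction k arbitrary: n)
  case (Suc k)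
  have "(f ^^ Suc k) (s (n + Suc k)) = f ((f ^^ k) (s (Suc n + k)))" by simp
  also have "\<dots> = s n" using Suc assms by (simp add: backward_orbit_def del: add_Suc)
  finally show ?case .
qed simp

lemma backward_orbit_iter_le:
  assumes "backward_orbit X f x s" "n \<le> m"
  shows "(f ^^ (m - n)) (s m) = s n"
  using backward_orbit_iter[OF assms(1), of "m - n" n] assms(2) by simp

lemma iter_in: "f ` X \<subseteq> X \<Longrightarrow> x \<in> X \<Longrightarrow> (f ^^ k) x \<in> X" for f :: "'a \<Rightarrow> 'a"
  by (induction k) auto

lemma special_alpha_limit_iff:
  assumes "f ` X \<subseteq> X"
  shows "y \<in> special_alpha_limit X f x \<longleftrightarrow> (\<exists>s. backward_orbit X f x s \<and> clusters_at s y)"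
proof
  assume "y \<in> special_alpha_limit X f x"
  then obtain t r where t: "bitrajectory X f x t" and r: "strict_mono (r :: nat \<Rightarrow> nat)"
    and lim: "(\<lambda>k. t (- int (r k))) \<longlonglongrightarrow> y"
    by (auto simp: special_alpha_limit_def alpha_limit_def)
  define s where "s = (\<lambda>n::nat. t (- int n))"
  have "f (s (Suc n)) = s n" for n
  proof -
    have "f (t (- int (Suc n))) = t (- int (Suc n) + 1)" using t by (auto simp: bitrajectory_def)
    then show ?thesis by (simp add: s_def)
  qed
  then have "backward_orbit X f x s"
    using t by (auto simp: backward_orbit_def bitrajectory_def s_def)
  moreover have "clusters_at s y"
    unfolding clusters_at_def
  proof (intro allI impI)
    fix \<eta> :: real and N :: nat
    assume "\<eta> > 0"
    then obtain k0 where k0: "\<And>k. k \<ge> k0 \<Longrightarrow> \<bar>s (r k) - y\<bar> < \<eta>"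
      using lim unfolding s_def LIMSEQ_def dist_real_def by blast
    have "r (max k0 N) \<ge> N" using seq_suble[OF r, of "max k0 N"] by linarith
    then show "\<exists>n\<ge>N. \<bar>s n - y\<bar> < \<eta>" using k0[of "max k0 N"] by auto
  qed
  ultimately show "\<exists>s. backward_orbit X f x s \<and> clusters_at s y" by blast
next
  assume "\<exists>s. backward_orbit X f x s \<and> clusters_at s y"
  then obtain s where s: "backward_orbit X f x s" and cl: "clusters_at s y" by blast
  define t where "t = (\<lambda>i::int. if i \<le> 0 then s (nat (- i)) else (f ^^ nat i) x)"
  have x: "x \<in> X" "s 0 = x" using s by (auto simp: backward_orbit_def)
  have "f (t i) = t (i + 1)" for i
  proof -
    consider "i < 0" | "i \<ge> 0" by linarith
    then show ?thesis
    proof cases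
      case 1
      then have "nat (- i) = Suc (nat (- (i + 1)))" by linarith
      then show ?thesis using 1 s by (simp add: t_def backward_orbit_def)
    next
      case 2
      then have "nat (i + 1) = Suc (nat i)" by linarith
      then show ?thesis using 2 x by (cases "i = 0") (auto simp: t_def)
    qed
  qed
  moreover have "t i \<in> X" for i
    using s x iter_in[OF assms x(1)] by (auto simp: t_def backward_orbit_def)
  ultimately have "bitrajectory X f x t" using x by (auto simp: bitrajectory_def t_def)
  moreover have "y \<in> alpha_limit t"
  proof -
    have "\<exists>r. \<forall>k. \<bar>s (r k) - y\<bar> < 1 / Suc k \<and> r k < r (Suc k)"
    proof (rule dependent_nat_choice)
      show "\<exists>n. \<bar>s n - y\<bar> < 1 / Suc 0" using cl[unfolded clusters_at_def, rule_format, of 1 0] by auto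
    next
      fix n k assume "\<bar>s n - y\<bar> < 1 / Suc k"
      show "\<exists>n'. \<bar>s n' - y\<bar> < 1 / Suc (Suc k) \<and> n < n'"
        using cl[unfolded clusters_at_def, rule_format, of "1 / Suc (Suc k)" "Suc n"]
        by (auto simp: Suc_le_eq)
    qed
    then obtain r where r: "\<And>k. \<bar>s (r k) - y\<bar> < 1 / Suc k" "\<And>k. r k < r (Suc k)" by blast
    have "(\<lambda>k. s (r k) - y) \<longlonglongrightarrow> 0"
      by (rule Lim_null_comparison[OF _ LIMSEQ_inverse_real_of_nat])
        (use r(1) in \<open>auto intro!: eventuallyI less_imp_le simp: inverse_eq_divide\<close>)
    then have "(\<lambda>k. s (r k)) \<longlonglongrightarrow> y" by (simp add: LIM_zero_iff)
    moreover have "strict_mono r" using r(2) by (simp add: strict_mono_Suc_iff)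
    ultimately show ?thesis by (auto simp: alpha_limit_def t_def intro!: exI[of _ r])
  qed
  ultimately show "y \<in> special_alpha_limit X f x" by (auto simp: special_alpha_limit_def)
qed

text \<open>To cluster at \<open>y\<close> it is enough to jump back arbitrarily close to \<open>y\<close> within a class of points from
which such a jump is always possible again. The jumps are concatenated into one backward orbit.\<close>

lemma clusters_by_jumps:
  assumes maps: "f ` X \<subseteq> X" and "P x" "x \<in> X"
    and step: "\<And>w \<eta>. P w \<Longrightarrow> w \<in> X \<Longrightarrow> \<eta> > 0 \<Longrightarrow>
      \<exists>w' k. w' \<in> X \<and> P w' \<and> k \<ge> 1 \<and> (f ^^ k) w' = w \<and> \<bar>w' - y\<bar> < \<eta>"
  shows "\<exists>s. backward_orbit X f x s \<and> clusters_at s y"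
proof -
  have "\<exists>w. \<forall>n. (P (w n) \<and> w n \<in> X \<and> (n = 0 \<longrightarrow> w n = x)) \<and>
     (\<exists>k\<ge>1. (f ^^ k) (w (Suc n)) = w n \<and> \<bar>w (Suc n) - y\<bar> < 1 / Suc n)"
  proof (rule dependent_nat_choice)
    show "\<exists>w. P w \<and> w \<in> X \<and> (0 = (0::nat) \<longrightarrow> w = x)" using assms by auto
  next
    fix w :: real and n :: nat
    assume "P w \<and> w \<in> X \<and> (n = 0 \<longrightarrow> w = x)"
    then show "\<exists>w'. (P w' \<and> w' \<in> X \<and> (Suc n = 0 \<longrightarrow> w' = x)) \<and>
        (\<exists>k\<ge>1. (f ^^ k) w' = w \<and> \<bar>w' - y\<bar> < 1 / Suc n)"
      using step[of w "1 / Suc n"] by auto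
  qed
  then obtain w where w0: "w 0 = x" and wX: "\<And>n. w n \<in> X"
    and "\<And>n. \<exists>k\<ge>1. (f ^^ k) (w (Suc n)) = w n \<and> \<bar>w (Suc n) - y\<bar> < 1 / Suc n" by blast
  then obtain k where k: "\<And>n. k n \<ge> 1" "\<And>n. (f ^^ k n) (w (Suc n)) = w n"
    and wy: "\<And>n. \<bar>w (Suc n) - y\<bar> < 1 / Suc n" by metis
  define \<sigma> where "\<sigma> = (\<lambda>n. \<Sum>i<n. k i)"
  have \<sigma>Suc: "\<sigma> (Suc n) = \<sigma> n + k n" for n by (simp add: \<sigma>_def)
  have \<sigma>ge: "\<sigma> n \<ge> n" for n
    by (induction n) (use k(1) in \<open>auto simp: \<sigma>Suc intro: add_mono le_SucI\<close>, metis Suc_eq_plus1 add_mono k(1))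
  have bk: "(f ^^ (\<sigma> (n + d) - \<sigma> n)) (w (n + d)) = w n \<and> \<sigma> n \<le> \<sigma> (n + d)" for n d
  proof (induction d)
    case (Suc d)
    have "\<sigma> (n + Suc d) - \<sigma> n = (\<sigma> (n + d) - \<sigma> n) + k (n + d)" using Suc by (simp add: \<sigma>Suc)
    then have "(f ^^ (\<sigma> (n + Suc d) - \<sigma> n)) (w (n + Suc d)) =
        (f ^^ (\<sigma> (n + d) - \<sigma> n)) ((f ^^ k (n + d)) (w (Suc (n + d))))"
      by (simp only: funpow_add comp_def add_Suc_right)
    then show ?case using Suc k(2)[of "n + d"] by (simp add: \<sigma>Suc)
  qed simp
  \<comment> \<open>Any \<open>n\<close> with \<open>\<sigma> n \<ge> m\<close> gives the same \<open>m\<close>-th point \<open>f ^^ (\<sigma> n - m)\<close> of \<open>w n\<close>;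
    \<open>n = m\<close> is such a choice, because every jump has length at least 1.\<close>
  define s where "s = (\<lambda>m. (f ^^ (\<sigma> m - m)) (w m))"
  have "f (s (Suc m)) = s m" for m
  proof -
    have "f (s (Suc m)) = (f ^^ Suc (\<sigma> (Suc m) - Suc m)) (w (Suc m))" by (simp add: s_def)
    also have "Suc (\<sigma> (Suc m) - Suc m) = (\<sigma> m - m) + k m"
      using \<sigma>ge[of "Suc m"] \<sigma>ge[of m] by (simp add: \<sigma>Suc)
    also have "(f ^^ \<dots>) (w (Suc m)) = s m" by (simp only: funpow_add k(2) s_def comp_def)
    finally show ?thesis .
  qed
  then have "backward_orbit X f x s"
    using iter_in[OF maps wX] w0 by (auto simp: backward_orbit_def s_def \<sigma>_def)
  moreover have "s (\<sigma> n) = w n" for n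
    using bk[of n "\<sigma> n - n"] \<sigma>ge[of n] by (simp add: s_def)
  then have "clusters_at s y"
    unfolding clusters_at_def
  proof (intro allI impI)
    fix \<eta> :: real and N :: nat
    assume s: "\<And>n. s (\<sigma> n) = w n" and "\<eta> > 0"
    then obtain n where n: "1 / Suc n < \<eta>" using nat_approx_posE by metis
    let ?n = "max n N"
    have "1 / Suc ?n \<le> 1 / Suc n" by (simp add: frac_le)
    then have "\<bar>w (Suc ?n) - y\<bar> < \<eta>" using wy[of ?n] n by linarith
    moreover have "\<sigma> (Suc ?n) \<ge> N" using \<sigma>ge[of "Suc ?n"] by linarith
    ultimately show "\<exists>n\<ge>N. \<bar>s n - y\<bar> < \<eta>" using s by metis
  qed
  ultimately show ?thesis by blast
qed

section \<open>Unimodal maps\<close>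

text \<open>A \<open>C\<^sup>1\<close> map of an interval with Lipschitz derivative and one turning point, which may be a maximum
or a minimum. Unlike the class of maps with a maximum and boundary values \<open>a\<close>, this one is
invariant under the reflection \<open>x \<mapsto> - x\<close>.\<close>

locale unimodal =
  fixes a b c :: real and f f' :: "real \<Rightarrow> real" and L :: real
  assumes ac: "a < c" and cb: "c < b"
    and maps: "f ` {a..b} \<subseteq> {a..b}"
    and deriv: "\<And>x. x \<in> {a..b} \<Longrightarrow> (f has_real_derivative f' x) (at x within {a..b})"
    and lipschitz: "\<And>x y. x \<in> {a..b} \<Longrightarrow> y \<in> {a..b} \<Longrightarrow> \<bar>f' x - f' y\<bar> \<le> L * \<bar>x - y\<bar>"
    and crit: "\<And>x. x \<in> {a..b} \<Longrightarrow> f' x = 0 \<Longrightarrow> x = c"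
    and turning: "(\<forall>x\<in>{a..b}. f x \<le> f c) \<or> (\<forall>x\<in>{a..b}. f c \<le> f x)"
begin

lemma reflect: "unimodal (- b) (- a) (- c) (\<lambda>x. - f (- x)) (\<lambda>x. f' (- x)) L"
proof
  fix x assume x: "x \<in> {- b..- a}"
  have "(f has_real_derivative f' (- x)) (at (- x) within uminus ` {-b..-a})"
    using deriv[of "- x"] x by (auto simp: image_uminus_atLeastAtMost)
  then have "((\<lambda>x. f (- x)) has_real_derivative f' (- x) * (- 1)) (at x within {-b..-a})"
    using DERIV_image_chain[of f "f' (- x)" uminus x "{- b..- a}" "- 1"]
      DERIV_minus[OF DERIV_ident, of x "{- b..- a}"]
    by (simp add: comp_def)
  then show "((\<lambda>x. - f (- x)) has_real_derivative f' (- x)) (at x within {- b..- a})"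
    using DERIV_minus by fastforce
next
  show "(\<lambda>x. - f (- x)) ` {- b..- a} \<subseteq> {- b..- a}"
  proof (intro image_subsetI)
    fix x assume "x \<in> {- b..- a}"
    then have "- x \<in> {a..b}" by auto
    then have "f (- x) \<in> {a..b}" using maps by blast
    then show "- f (- x) \<in> {- b..- a}" by auto
  qed
  fix x y assume "x \<in> {- b..- a}" "y \<in> {- b..- a}"
  then show "\<bar>f' (- x) - f' (- y)\<bar> \<le> L * \<bar>x - y\<bar>"
    using lipschitz[of "- x" "- y"] by (simp add: abs_minus_commute)
next
  fix x assume "x \<in> {- b..- a}" "f' (- x) = 0"
  then show "x = - c" using crit[of "- x"] by auto
next
  have "- x \<in> {a..b}" if "x \<in> {- b..- a}" for x using that by auto
  then show "(\<forall>x\<in>{- b..- a}. - f (- x) \<le> - f (- (- c))) \<or> (\<forall>x\<in>{- b..- a}. - f (- (- c)) \<le> - f (- x))"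
    using turning by auto
qed (use ac cb in auto)

lemma iter_mem: "x \<in> {a..b} \<Longrightarrow> (f ^^ k) x \<in> {a..b}"
  using iter_in[OF maps] .

lemma f_mem: "x \<in> {a..b} \<Longrightarrow> f x \<in> {a..b}"
  using maps by blast

lemma cont: "continuous_on {a..b} f"
  using deriv by (meson DERIV_continuous continuous_on_eq_continuous_within)

lemma cont_iter: "continuous_on {a..b} (f ^^ k)"
proof (induction k)
  case (Suc k)
  have "continuous_on ((f ^^ k) ` {a..b}) f"
    using iter_mem by (intro continuous_on_subset[OF cont]) blast
  then show ?case using continuous_on_compose[OF Suc, of f] by (simp add: comp_def)
qed (simp add: continuous_on_id)

lemma c_mem: "c \<in> {a..b}" using ac cb by auto

lemma mvt_f:
  assumes "x \<in> {a..b}" "y \<in> {a..b}" "x \<noteq> y"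
  shows "\<exists>\<xi>. min x y < \<xi> \<and> \<xi> < max x y \<and> \<bar>f y - f x\<bar> = \<bar>f' \<xi>\<bar> * \<bar>y - x\<bar>"
proof -
  have *: "\<exists>\<xi>. x < \<xi> \<and> \<xi> < y \<and> f y - f x = f' \<xi> * (y - x)"
    if "x \<in> {a..b}" "y \<in> {a..b}" "x < y" for x y
  proof -
    have "\<exists>\<xi>\<in>{x<..<y}. f y - f x = (\<lambda>h. f' \<xi> * h) (y - x)"
    proof (rule mvt_simple[OF \<open>x < y\<close>, of f "\<lambda>\<xi> h. f' \<xi> * h"])
      fix z assume "x \<le> z" "z \<le> y"
      then have "(f has_real_derivative f' z) (at z within {x..y})"
        using that by (intro DERIV_subset[OF deriv]) auto
      then show "(f has_derivative (\<lambda>h. f' z * h)) (at z within {x..y})"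
        by (simp add: has_field_derivative_def)
    qed
    then show ?thesis by auto
  qed
  show ?thesis
  proof (cases "x < y")
    case True
    then show ?thesis using *[OF assms(1,2)] by (auto simp: abs_mult)
  next
    case False
    then have "y < x" using assms by auto
    then show ?thesis using *[OF assms(2,1)] by (auto simp: abs_mult abs_minus_commute[of "f y"] abs_minus_commute[of y])
  qed
qed

text \<open>\<open>f\<close> is injective on intervals that do not contain \<open>c\<close> in their interior.\<close>

lemma inj_side:
  assumes "S \<subseteq> {a..b}" "connected S" "\<And>x y. x \<in> S \<Longrightarrow> y \<in> S \<Longrightarrow> x < c \<Longrightarrow> y \<le> c"
  shows "inj_on f S"
proof (rule inj_onI, rule ccontr)
  fix x y assume xy: "x \<in> S" "y \<in> S" "f x = f y" "x \<noteq> y"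
  then obtain \<xi> where \<xi>: "min x y < \<xi>" "\<xi> < max x y" "f' \<xi> = 0"
    using mvt_f[of x y] assms(1) by fastforce
  have "\<xi> \<in> {a..b}" using \<xi> xy(1,2) assms(1) by (auto simp: min_def max_def subset_iff split: if_splits)
  then have "\<xi> = c" using crit \<xi> by blast
  then show False using assms(3)[of "min x y" "max x y"] xy \<xi> by (auto simp: min_def max_def split: if_splits)
qed

lemma inj_avoiding_c:
  assumes "S \<subseteq> {a..b}" "connected S" "c \<notin> S"
  shows "inj_on f S"
proof (rule inj_side[OF assms(1,2)])
  fix x y assume "x \<in> S" "y \<in> S" "x < c"
  then show "y \<le> c" using connectedD_interval[OF assms(2), of x y c] assms(3) by force
qed

lemma connected_iter: "connected S \<Longrightarrow> S \<subseteq> {a..b} \<Longrightarrow> connected ((f ^^ k) ` S)"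
  by (meson connected_continuous_image cont_iter continuous_on_subset)

lemma iter_sub: "S \<subseteq> {a..b} \<Longrightarrow> (f ^^ k) ` S \<subseteq> {a..b}"
  using iter_mem by blast

lemma inj_iter:
  assumes "S \<subseteq> {a..b}" "connected S" "\<And>j. j < k \<Longrightarrow> c \<notin> (f ^^ j) ` S"
  shows "inj_on (f ^^ k) S"
  using assms(3)
proof (induction k)
  case (Suc k)
  have "inj_on f ((f ^^ k) ` S)"
    using Suc.prems[of k] assms connected_iter iter_sub by (intro inj_avoiding_c) auto
  then have "inj_on (f \<circ> (f ^^ k)) S" using Suc by (intro comp_inj_on) auto
  then show ?case by (simp add: comp_def)
qed simp

lemma inj_iter_le:
  assumes "inj_on (f ^^ k) S" "j \<le> k"
  shows "inj_on (f ^^ j) S"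
proof -
  have "f ^^ k = (f ^^ (k - j)) \<circ> (f ^^ j)" using assms(2) by (simp flip: funpow_add)
  then show ?thesis using assms(1) inj_on_imageI2 by metis
qed

lemma mono_or_anti:
  assumes "S \<subseteq> {a..b}" "connected S" "inj_on (f ^^ k) S"
  shows "strict_mono_on S (f ^^ k) \<or> strict_antimono_on S (f ^^ k)"
  using injective_eq_monotone_map[of S "f ^^ k"] assms continuous_on_subset[OF cont_iter]
  by (simp add: is_interval_connected_1)

end

section \<open>Periodic intervals\<close>

context unimodal
begin

lemma iter_add: "(f ^^ (i + j)) u = (f ^^ i) ((f ^^ j) u)"
  by (simp add: funpow_add)

text \<open>An interval mapped into itself by \<open>f ^^ p\<close> such that images taken at times in different residue classes
modulo \<open>p\<close> are disjoint. The interval need be neither open nor closed.\<close>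

definition periodic_interval :: "real set \<Rightarrow> nat \<Rightarrow> bool" where
  "periodic_interval K p \<longleftrightarrow> K \<subseteq> {a..b} \<and> K \<noteq> {} \<and> connected K \<and> p \<ge> 1 \<and> (f ^^ p) ` K \<subseteq> K \<and>
     (\<forall>i j. (f ^^ i) ` K \<inter> (f ^^ j) ` K \<noteq> {} \<longrightarrow> i mod p = j mod p)"

lemma periodic_intervalD:
  assumes "periodic_interval K p"
  shows "K \<subseteq> {a..b}" "K \<noteq> {}" "connected K" "p \<ge> 1" "p > 0" "(f ^^ p) ` K \<subseteq> K"
  using assms by (auto simp: periodic_interval_def)

lemma periodic_interval_disjoint:
  assumes "periodic_interval K p" "u \<in> K" "v \<in> K" "(f ^^ i) u = (f ^^ j) v"
  shows "i mod p = j mod p"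
proof -
  have "(f ^^ i) u \<in> (f ^^ i) ` K" using assms(2) by (rule imageI)
  moreover have "(f ^^ i) u \<in> (f ^^ j) ` K" unfolding assms(4) using assms(3) by (rule imageI)
  ultimately show ?thesis using assms(1) unfolding periodic_interval_def by blast
qed

lemma periodic_interval_return:
  assumes "periodic_interval K p" "u \<in> K" "(f ^^ k) u \<in> K"
  shows "p dvd k"
  using periodic_interval_disjoint[OF assms(1,2,3), of k 0] by (simp add: mod_eq_0_iff_dvd)

lemma periodic_interval_dvd:
  assumes "periodic_interval K p" "p dvd k" "u \<in> K"
  shows "(f ^^ k) u \<in> K"
proof -
  obtain n where k: "k = p * n" using assms(2) by blast
  have "(f ^^ (p * n)) u \<in> K"
  proof (induction n)
    case (Suc n)
    have "(f ^^ (p * Suc n)) u = (f ^^ p) ((f ^^ (p * n)) u)" by (simp add: funpow_add)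
    then show ?case using Suc periodic_intervalD(6)[OF assms(1)] by auto
  qed (use assms in simp)
  then show ?thesis using k by simp
qed

lemma periodic_interval_mod:
  assumes "periodic_interval K p" "i mod p = j mod p" "j \<le> i"
  shows "(f ^^ i) ` K \<subseteq> (f ^^ j) ` K"
proof (intro image_subsetI)
  fix u assume u: "u \<in> K"
  have "p dvd i - j" using assms(2,3) by (metis mod_eq_dvd_iff_nat)
  then have "(f ^^ (i - j)) u \<in> K" using periodic_interval_dvd assms(1) u by blast
  moreover have "(f ^^ i) u = (f ^^ j) ((f ^^ (i - j)) u)" using assms(3) by (simp flip: iter_add)
  ultimately show "(f ^^ i) u \<in> (f ^^ j) ` K" by blast
qed

text \<open>The images of a periodic interval at times less than \<open>p\<close> are disjoint, so at most one of them contains \<open>c\<close>.\<close>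

lemma inj_iter_before_c:
  assumes "periodic_interval K p" "i < p" "d \<in> K" "(f ^^ i) d = c"
  shows "inj_on (f ^^ i) K"
proof (rule inj_iter)
  fix j assume j: "j < i"
  show "c \<notin> (f ^^ j) ` K"
  proof
    assume "c \<in> (f ^^ j) ` K"
    then obtain v where "v \<in> K" "(f ^^ j) v = (f ^^ i) d" using assms by auto
    then have "j mod p = i mod p" using periodic_interval_disjoint[OF assms(1)] assms(3) by blast
    then show False using j assms(2) by simp
  qed
qed (use periodic_intervalD[OF assms(1)] in auto)

text \<open>If \<open>f ^^ i\<close> takes \<open>d \<in> K\<close> to \<open>c\<close>, then the return map \<open>f ^^ p\<close> is a unimodal map of \<open>K\<close> turning at \<open>d\<close>: it
is the composition of an injective map, of \<open>f\<close> and of another injective map. In the case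
of a minimum only the extremality is recorded.\<close>

lemma iter_turning_point:
  assumes K: "periodic_interval K p" and i: "i < p" and d: "d \<in> K" "(f ^^ i) d = c"
  shows "((\<forall>z\<in>K. (f ^^ p) z \<le> (f ^^ p) d) \<and> strict_mono_on (K \<inter> {..d}) (f ^^ p) \<and>
            strict_antimono_on (K \<inter> {d..}) (f ^^ p))
         \<or> (\<forall>z\<in>K. (f ^^ p) d \<le> (f ^^ p) z)"
proof -
  note KD = periodic_intervalD[OF K]
  define S where "S = (f ^^ Suc i) ` K"
  define h where "h = f ^^ (p - 1 - i)"
  have S: "S \<subseteq> {a..b}" "connected S"
    using connected_iter[OF KD(3,1)] iter_sub[OF KD(1)] by (auto simp: S_def simp del: funpow.simps)
  have inj\<phi>: "inj_on (f ^^ i) K" using inj_iter_before_c assms by blast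
  have injh: "inj_on h S" unfolding h_def
  proof (rule inj_iter[OF S])
    fix j assume j: "j < p - 1 - i"
    show "c \<notin> (f ^^ j) ` S"
    proof
      assume "c \<in> (f ^^ j) ` S"
      then obtain v where v: "v \<in> K" "(f ^^ j) ((f ^^ Suc i) v) = (f ^^ i) d"
        using d by (auto simp: S_def simp del: funpow.simps)
      then have "(f ^^ (j + Suc i)) v = (f ^^ i) d" by (simp only: iter_add)
      then have "(j + Suc i) mod p = i mod p"
        using periodic_interval_disjoint[OF K v(1) d(1)] by blast
      then show False using j i by simp
    qed
  qed
  have g: "(f ^^ p) z = h (f ((f ^^ i) z))" for z
  proof -
    have "(f ^^ ((p - 1 - i) + Suc i)) z = h (f ((f ^^ i) z))" unfolding h_def iter_add by simp
    moreover have "(p - 1 - i) + Suc i = p" using i by simp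
    ultimately show ?thesis by simp
  qed
  have fS: "f ((f ^^ i) z) \<in> S" if "z \<in> K" for z using that by (auto simp: S_def)
  have injA: "inj_on (f ^^ p) A"
    if A: "A \<subseteq> K" "connected A" and side: "(\<forall>x\<in>A. x \<le> d) \<or> (\<forall>x\<in>A. d \<le> x)" for A
  proof -
    have "inj_on f ((f ^^ i) ` A)"
    proof (rule inj_side)
      show "(f ^^ i) ` A \<subseteq> {a..b}" "connected ((f ^^ i) ` A)"
        using iter_sub connected_iter A KD(1) by (meson subset_trans)+
      have "(\<forall>x\<in>A. (f ^^ i) x \<le> c) \<or> (\<forall>x\<in>A. c \<le> (f ^^ i) x)"
      proof -
        consider "strict_mono_on K (f ^^ i)" | "strict_antimono_on K (f ^^ i)"
          using mono_or_anti[OF KD(1,3) inj\<phi>] by blast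
        then show ?thesis
        proof cases
          case 1
          then have "(f ^^ i) x \<le> (f ^^ i) z" if "x \<in> K" "z \<in> K" "x \<le> z" for x z
            using that by (cases "x = z") (auto simp: monotone_on_def less_le)
          then have "(\<forall>x\<in>A. (f ^^ i) x \<le> (f ^^ i) d) \<or> (\<forall>x\<in>A. (f ^^ i) d \<le> (f ^^ i) x)"
            using side A(1) d(1) by blast
          then show ?thesis using d(2) by simp
        next
          case 2
          then have "(f ^^ i) z \<le> (f ^^ i) x" if "x \<in> K" "z \<in> K" "x \<le> z" for x z
            using that by (cases "x = z") (auto simp: monotone_on_def less_le)
          then have "(\<forall>x\<in>A. (f ^^ i) x \<le> (f ^^ i) d) \<or> (\<forall>x\<in>A. (f ^^ i) d \<le> (f ^^ i) x)"
            using side A(1) d(1) by blast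
          then show ?thesis using d(2) by simp
        qed
      qed
      then show "y \<le> c" if "x \<in> (f ^^ i) ` A" "y \<in> (f ^^ i) ` A" "x < c" for x y
        using that by fastforce
    qed
    moreover have "inj_on h (f ` (f ^^ i) ` A)"
      using injh by (rule inj_on_subset) (use A fS in auto)
    moreover have "inj_on (f ^^ i) A" using inj\<phi> A inj_on_subset by blast
    ultimately have "inj_on (h \<circ> (f \<circ> (f ^^ i))) A"
      by (intro comp_inj_on) (auto simp: image_comp)
    then show ?thesis using g by (metis (no_types, lifting) comp_apply inj_on_cong)
  qed
  have conL: "connected (K \<inter> {..d})" "connected (K \<inter> {d..})"
    using KD(3) by (auto simp: connected_iff_interval intro: is_interval_connected_1 is_interval_Int)
  have injL: "inj_on (f ^^ p) (K \<inter> {..d})" and injR: "inj_on (f ^^ p) (K \<inter> {d..})"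
    using injA conL by auto
  have ext: "(\<forall>z\<in>K. (f ^^ p) z \<le> (f ^^ p) d) \<or> (\<forall>z\<in>K. (f ^^ p) d \<le> (f ^^ p) z)"
  proof -
    have fext: "(\<forall>z\<in>K. f ((f ^^ i) z) \<le> f ((f ^^ i) d)) \<or> (\<forall>z\<in>K. f ((f ^^ i) d) \<le> f ((f ^^ i) z))"
    proof -
      have "(f ^^ i) z \<in> {a..b}" if "z \<in> K" for z using iter_mem KD(1) that by blast
      then show ?thesis using turning d(2) by blast
    qed
    consider "strict_mono_on S h" | "strict_antimono_on S h"
      using mono_or_anti[OF S injh[unfolded h_def]] h_def by blast
    then show ?thesis
    proof cases
      case 1
      then have "mono_on S h" by (rule strict_mono_on_imp_mono_on)
      then show ?thesis using fext fS d g by (metis mono_onD)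
    next
      case 2
      then have "x \<in> S \<Longrightarrow> y \<in> S \<Longrightarrow> x \<le> y \<Longrightarrow> h y \<le> h x" for x y
        by (cases "x = y") (auto simp: monotone_on_def less_le)
      then show ?thesis using fext fS d g by metis
    qed
  qed
  show ?thesis
  proof (cases "\<forall>z\<in>K. (f ^^ p) d \<le> (f ^^ p) z")
    case False
    then have mx: "\<forall>z\<in>K. (f ^^ p) z \<le> (f ^^ p) d" using ext by blast
    have "strict_mono_on (K \<inter> {..d}) (f ^^ p)"
      using mono_or_anti[OF _ conL(1) injL]
    proof
      assume anti: "strict_antimono_on (K \<inter> {..d}) (f ^^ p)"
      have "(f ^^ p) d < (f ^^ p) x" if "x \<in> K" "x < d" for x
        using monotone_onD[OF anti, of x d] that d by auto
      then have "\<not> x < d" if "x \<in> K" for x using mx that by fastforce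
      then show ?thesis by (force simp: monotone_on_def)
    qed (use KD(1) in auto)
    moreover have "strict_antimono_on (K \<inter> {d..}) (f ^^ p)"
      using mono_or_anti[OF _ conL(2) injR]
    proof
      assume mon: "strict_mono_on (K \<inter> {d..}) (f ^^ p)"
      have "(f ^^ p) d < (f ^^ p) x" if "x \<in> K" "d < x" for x
        using monotone_onD[OF mon, of d x] that d by auto
      then have "\<not> d < x" if "x \<in> K" for x using mx that by fastforce
      then show ?thesis by (force simp: monotone_on_def)
    qed (use KD(1) in auto)
    ultimately show ?thesis using mx by blast
  qed blast
qed

end

section \<open>Intervals generated by left neighbourhoods of a limit point\<close>

lemma mod_add_left_cancel:
  fixes p :: nat
  shows "(N + i) mod p = (N + j) mod p \<Longrightarrow> i mod p = j mod p"
  by (simp add: nat_mod_eq_iff)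

text \<open>The situation to be refuted: \<open>y\<close> is approached from the left by cluster points of backward orbits of \<open>x\<close>,
but is not itself such a cluster point.\<close>

locale left_limit = unimodal +
  fixes x y :: real
  assumes x_mem: "x \<in> {a..b}" and y_le: "y \<le> b"
    and accum: "\<And>\<delta>. \<delta> > 0 \<Longrightarrow> \<exists>z s. backward_orbit {a..b} f x s \<and> clusters_at s z \<and> y - \<delta> < z \<and> z < y"
    and no_cluster: "\<And>s. backward_orbit {a..b} f x s \<Longrightarrow> \<not> clusters_at s y"
begin

text \<open>The left neighbourhood of \<open>y\<close> of width \<open>e\<close>.\<close>

definition U :: "real \<Rightarrow> real set" where "U e = {y - e<..<y}"

text \<open>The points that are reached from \<open>U e\<close>.\<close>

definition M :: "real \<Rightarrow> real set" where "M e = (\<Union>k. (f ^^ k) ` U e)"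

text \<open>The component of \<open>M e\<close> containing \<open>U e\<close>, for which the midpoint serves as a base point.\<close>

definition K :: "real \<Rightarrow> real set" where "K e = connected_component_set (M e) (y - e / 2)"

text \<open>The first return time of \<open>K e\<close>.\<close>

definition per :: "real \<Rightarrow> nat" where "per e = (LEAST j. 1 \<le> j \<and> (f ^^ j) ` K e \<subseteq> K e)"

text \<open>The widths for which \<open>U e\<close> lies in the interval \<open>{a..b}\<close>.\<close>

definition ok :: "real \<Rightarrow> bool" where "ok e \<longleftrightarrow> 0 < e \<and> e \<le> y - a"

lemma orbit_mem: "backward_orbit {a..b} f x s \<Longrightarrow> s n \<in> {a..b}"
  by (simp add: backward_orbit_def)

lemma cluster_mem:
  assumes "backward_orbit {a..b} f x s" "clusters_at s z"
  shows "z \<in> {a..b}"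
proof -
  have "z \<in> closure {a..b}"
    unfolding closure_approachable dist_real_def
    using assms(2) orbit_mem[OF assms(1)] unfolding clusters_at_def by blast
  then show ?thesis by simp
qed

lemma a_less_y: "a < y"
proof -
  obtain z s where "backward_orbit {a..b} f x s" "clusters_at s z" "z < y" using accum[of 1] by auto
  then show ?thesis using cluster_mem[of s z] by auto
qed

lemma ok_top: "ok (y - a)" using a_less_y by (simp add: ok_def)

lemma ok_le: "ok e \<Longrightarrow> 0 < e' \<Longrightarrow> e' \<le> e \<Longrightarrow> ok e'" by (simp add: ok_def)

lemma U_sub: "ok e \<Longrightarrow> U e \<subseteq> {a..b}" using y_le by (auto simp: U_def ok_def)

lemma mid_U: "ok e \<Longrightarrow> y - e / 2 \<in> U e" by (auto simp: U_def ok_def)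

lemma U_M: "U e \<subseteq> M e"
  unfolding M_def by (auto intro!: exI[of _ "0::nat"])

lemma M_iter: "(f ^^ k) ` M e \<subseteq> M e"
  unfolding M_def by (force simp flip: iter_add)

lemma M_sub: "ok e \<Longrightarrow> M e \<subseteq> {a..b}"
  unfolding M_def using iter_sub U_sub by blast

lemma K_M: "K e \<subseteq> M e" by (simp add: K_def connected_component_subset)

lemma K_sub: "ok e \<Longrightarrow> K e \<subseteq> {a..b}" using K_M M_sub by blast

lemma K_conn: "connected (K e)" by (simp add: K_def)

lemma K_max:
  assumes "ok e" "connected S" "S \<subseteq> M e" "S \<inter> K e \<noteq> {}"
  shows "S \<subseteq> K e"
proof -
  obtain v where v: "v \<in> S" "v \<in> K e" using assms by blast
  have "S \<subseteq> connected_component_set (M e) v" using v assms by (intro connected_component_maximal)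
  also have "\<dots> = K e" using v unfolding K_def by (metis connected_component_eq)
  finally show ?thesis .
qed

lemma mid_K: "ok e \<Longrightarrow> y - e / 2 \<in> K e"
  unfolding K_def using mid_U U_M by (auto simp: connected_component_refl)

lemma U_K:
  assumes "ok e"
  shows "U e \<subseteq> K e"
proof (rule K_max[OF assms _ U_M])
  show "U e \<inter> K e \<noteq> {}" using mid_U[OF assms] mid_K[OF assms] by blast
qed (simp add: U_def)

lemma K_return_sub:
  assumes "ok e" "u \<in> K e" "(f ^^ k) u \<in> K e"
  shows "(f ^^ k) ` K e \<subseteq> K e"
proof (rule K_max[OF assms(1)])
  show "connected ((f ^^ k) ` K e)" using connected_iter K_conn K_sub assms(1) by blast
  show "(f ^^ k) ` K e \<subseteq> M e" using M_iter K_M by blast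
  show "(f ^^ k) ` K e \<inter> K e \<noteq> {}" using assms by blast
qed

lemma visits:
  assumes "clusters_at s z" "z \<in> V" "open V"
  shows "\<exists>n\<ge>N. s n \<in> V"
proof -
  obtain \<eta> where "\<eta> > 0" "\<And>w. \<bar>w - z\<bar> < \<eta> \<Longrightarrow> w \<in> V"
    using assms(2,3) unfolding open_dist dist_real_def by blast
  then show ?thesis using assms(1) unfolding clusters_at_def by blast
qed

lemma accum_U:
  assumes "ok e"
  obtains z s where "backward_orbit {a..b} f x s" "clusters_at s z" "z \<in> U e"
    "\<And>N. \<exists>n\<ge>N. s n \<in> U e"
proof -
  obtain z s where z: "backward_orbit {a..b} f x s" "clusters_at s z" "y - e < z" "z < y"
    using accum[of e] assms by (auto simp: ok_def)
  then have "z \<in> U e" by (simp add: U_def)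
  moreover have "open (U e)" by (simp add: U_def)
  ultimately show ?thesis using that z visits by blast
qed

lemma per_prop:
  assumes "ok e"
  shows "1 \<le> per e" "(f ^^ per e) ` K e \<subseteq> K e"
proof -
  obtain z s where s: "backward_orbit {a..b} f x s" "\<And>N. \<exists>n\<ge>N. s n \<in> U e"
    using accum_U[OF assms] by metis
  then obtain n m where nm: "s n \<in> U e" "m \<ge> Suc n" "s m \<in> U e" by meson
  have "(f ^^ (m - n)) (s m) = s n" using backward_orbit_iter_le[OF s(1)] nm by simp
  moreover have "s m \<in> K e" "s n \<in> K e" using nm U_K[OF assms] by auto
  ultimately have "(f ^^ (m - n)) ` K e \<subseteq> K e"
    using K_return_sub[OF assms, of "s m" "m - n"] by simp
  then have "1 \<le> m - n \<and> (f ^^ (m - n)) ` K e \<subseteq> K e" using nm by simp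
  then have "1 \<le> per e \<and> (f ^^ per e) ` K e \<subseteq> K e" unfolding per_def by (rule LeastI)
  then show "1 \<le> per e" "(f ^^ per e) ` K e \<subseteq> K e" by auto
qed

lemma per_mult: "ok e \<Longrightarrow> u \<in> K e \<Longrightarrow> (f ^^ (per e * n)) u \<in> K e"
proof (induction n)
  case (Suc n)
  have "(f ^^ (per e * Suc n)) u = (f ^^ per e) ((f ^^ (per e * n)) u)" by (simp add: iter_add)
  then show ?case using Suc per_prop[OF Suc.prems(1)] by auto
qed simp

lemma per_dvd:
  assumes "ok e" "(f ^^ k) ` K e \<subseteq> K e"
  shows "per e dvd k"
proof -
  let ?r = "k mod per e" and ?q = "k div per e"
  let ?u = "(f ^^ (per e * ?q)) (y - e / 2)"
  have u: "?u \<in> K e" using per_mult assms mid_K by blast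
  have "(f ^^ ?r) ?u = (f ^^ (?r + per e * ?q)) (y - e / 2)" by (simp only: iter_add)
  also have "\<dots> = (f ^^ k) (y - e / 2)" by simp
  also have "\<dots> \<in> K e" using assms mid_K by blast
  finally have "(f ^^ ?r) ` K e \<subseteq> K e" using K_return_sub[OF assms(1) u] by blast
  moreover have "?r < per e" using per_prop[OF assms(1)] by simp
  ultimately have "\<not> 1 \<le> ?r" unfolding per_def using not_less_Least by blast
  then have "?r = 0" by simp
  then show ?thesis by (simp add: mod_eq_0_iff_dvd)
qed

lemma K_periodic:
  assumes "ok e"
  shows "periodic_interval (K e) (per e)"
  unfolding periodic_interval_def
proof (intro conjI allI impI)
  fix i j assume "(f ^^ i) ` K e \<inter> (f ^^ j) ` K e \<noteq> {}"
  then obtain u v where uv: "u \<in> K e" "v \<in> K e" "(f ^^ i) u = (f ^^ j) v" by blast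
  define N where "N = per e * i - i"
  have N: "N + i = per e * i" using per_prop[OF assms] by (simp add: N_def)
  have "(f ^^ (N + j)) v = (f ^^ (N + i)) u" by (simp only: iter_add uv)
  also have "\<dots> \<in> K e" using per_mult[OF assms uv(1)] N by simp
  finally have "per e dvd N + j" using K_return_sub[OF assms uv(2)] per_dvd[OF assms] by blast
  moreover have "per e dvd N + i" using N by simp
  ultimately show "i mod per e = j mod per e"
    by - (rule mod_add_left_cancel[of N], simp add: dvd_imp_mod_0)
next
  show "K e \<noteq> {}" using mid_K[OF assms] by blast
qed (use assms K_sub K_conn per_prop in auto)

lemma M_pieces:
  assumes "ok e" "w \<in> M e"
  shows "\<exists>j<per e. w \<in> (f ^^ j) ` K e"
proof -
  obtain k u where k: "u \<in> U e" "w = (f ^^ k) u" using assms(2) unfolding M_def by blast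
  then have "w \<in> (f ^^ k) ` K e" using U_K assms by blast
  moreover have "(f ^^ k) ` K e \<subseteq> (f ^^ (k mod per e)) ` K e"
    by (rule periodic_interval_mod[OF K_periodic[OF assms(1)]]) auto
  ultimately show ?thesis using per_prop(1)[OF assms(1)]
    by (intro exI[of _ "k mod per e"]) auto
qed

lemma M_mono: "e' \<le> e \<Longrightarrow> M e' \<subseteq> M e"
  unfolding M_def U_def by force

lemma K_mono:
  assumes "ok e" "0 < e'" "e' \<le> e"
  shows "K e' \<subseteq> K e"
proof (rule K_max[OF assms(1) K_conn])
  have ok': "ok e'" using assms ok_le by blast
  show "K e' \<subseteq> M e" using K_M M_mono assms by blast
  have "y - e' / 2 \<in> U e" using assms by (auto simp: U_def)
  then show "K e' \<inter> K e \<noteq> {}" using mid_K[OF ok'] U_K[OF assms(1)] by blast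
qed

lemma per_mono_dvd:
  assumes "ok e" "0 < e'" "e' \<le> e"
  shows "per e dvd per e'"
proof -
  have ok': "ok e'" using assms ok_le by blast
  have "y - e' / 2 \<in> K e'" "(f ^^ per e') (y - e' / 2) \<in> K e'"
    using mid_K[OF ok'] per_prop[OF ok'] by auto
  then show ?thesis
    using K_mono[OF assms] periodic_interval_return[OF K_periodic[OF assms(1)]] by blast
qed

text \<open>A point is good if it is reached from every left neighbourhood of \<open>y\<close> after arbitrarily long times.
In particular it lies in every \<open>M e\<close>.\<close>

definition good :: "real \<Rightarrow> bool" where
  "good w \<longleftrightarrow> (\<forall>e. ok e \<longrightarrow> (\<forall>N. \<exists>k\<ge>N. w \<in> (f ^^ k) ` U e))"

lemma good_x: "good x"
  unfolding good_def
proof (intro allI impI)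
  fix e N assume "ok e"
  then obtain z s where s: "backward_orbit {a..b} f x s" "\<And>N. \<exists>n\<ge>N. s n \<in> U e"
    using accum_U by metis
  then obtain n where n: "n \<ge> N" "s n \<in> U e" by blast
  have "(f ^^ n) (s n) = x" using backward_orbit_iter[OF s(1), of n 0] s(1) by (simp add: backward_orbit_def)
  then show "\<exists>k\<ge>N. x \<in> (f ^^ k) ` U e" using n by blast
qed

lemma good_M: "good w \<Longrightarrow> ok e \<Longrightarrow> w \<in> M e"
  unfolding good_def M_def by blast

text \<open>If \<open>U \<delta>\<close> were contained in all \<open>M e\<close>, every point of \<open>U \<delta>\<close> would have preimages in \<open>U \<delta>\<close> arbitrarily close
to \<open>y\<close>, and \<open>clusters_by_jumps\<close> would apply.\<close>

lemma M_not_absorbing: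
  assumes "ok \<delta>"
  shows "\<exists>e. ok e \<and> e \<le> \<delta> \<and> \<not> U \<delta> \<subseteq> M e"
proof (rule ccontr)
  assume "\<nexists>e. ok e \<and> e \<le> \<delta> \<and> \<not> U \<delta> \<subseteq> M e"
  then have sub: "\<And>e. ok e \<Longrightarrow> e \<le> \<delta> \<Longrightarrow> U \<delta> \<subseteq> M e" by blast
  define P where "P w \<longleftrightarrow> (\<forall>e. ok e \<longrightarrow> (\<exists>k\<ge>1. w \<in> (f ^^ k) ` U e))" for w
  have PU: "P w" if w: "w \<in> U \<delta>" for w
    unfolding P_def
  proof (intro allI impI)
    fix e assume "ok e"
    \<comment> \<open>With this width \<open>w\<close> itself is outside \<open>U e'\<close>, which forces a positive number of steps.\<close>
    define e' where "e' = min (min e \<delta>) (y - w)"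
    have "0 < e'" using \<open>ok e\<close> assms w by (auto simp: e'_def ok_def U_def)
    moreover have "e' \<le> \<delta>" by (simp add: e'_def)
    ultimately have "w \<in> M e'" using sub[of e'] w ok_le[OF assms, of e'] by blast
    then obtain k u where k: "w = (f ^^ k) u" "u \<in> U e'" unfolding M_def by blast
    have "w \<notin> U e'" by (auto simp: U_def e'_def)
    then have "k \<ge> 1" using k by (cases k) auto
    moreover have "u \<in> U e" using k by (auto simp: U_def e'_def)
    ultimately show "\<exists>k\<ge>1. w \<in> (f ^^ k) ` U e" using k by blast
  qed
  have "\<exists>s. backward_orbit {a..b} f x s \<and> clusters_at s y"
  proof (rule clusters_by_jumps[OF maps, of P])
    show "P x" using good_x unfolding P_def good_def by blast
    fix w \<eta> :: real assume w: "P w" "0 < \<eta>"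
    define e where "e = min \<delta> \<eta>"
    have e: "ok e" using assms w ok_le[OF assms, of e] by (auto simp: e_def ok_def)
    then obtain k u where k: "k \<ge> 1" "w = (f ^^ k) u" "u \<in> U e" using w unfolding P_def by blast
    have "u \<in> U \<delta>" "\<bar>u - y\<bar> < \<eta>" using k(3) by (auto simp: U_def e_def)
    then show "\<exists>w' k. w' \<in> {a..b} \<and> P w' \<and> k \<ge> 1 \<and> (f ^^ k) w' = w \<and> \<bar>w' - y\<bar> < \<eta>"
      using k PU U_sub[OF assms] by blast
  qed (use x_mem in auto)
  then show False using no_cluster by blast
qed

text \<open>The left endpoint of \<open>K e\<close> tends to \<open>y\<close> as \<open>e\<close> tends to 0.\<close>

lemma K_left_end:
  assumes "\<delta> > 0"
  obtains e1 where "ok e1" "e1 \<le> \<delta>" "\<And>e u. 0 < e \<Longrightarrow> e \<le> e1 \<Longrightarrow> u \<in> K e \<Longrightarrow> y - \<delta> < u"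
proof -
  define \<delta>' where "\<delta>' = min \<delta> (y - a)"
  have d': "ok \<delta>'" using assms a_less_y by (auto simp: \<delta>'_def ok_def)
  obtain e1 z where e1: "ok e1" "e1 \<le> \<delta>'" "z \<in> U \<delta>'" "z \<notin> M e1" using M_not_absorbing[OF d'] by blast
  have "y - \<delta> < u" if "0 < e" "e \<le> e1" "u \<in> K e" for e u
  proof (rule ccontr)
    assume nu: "\<not> y - \<delta> < u"
    have oke: "ok e" using ok_le e1 that by blast
    have "z \<notin> M e" using e1 M_mono that by blast
    then have z: "z \<notin> U e" "z \<notin> K e" using U_M K_M by auto
    have "u \<le> z" "z \<le> y - e / 2" using nu z e1(3) oke by (auto simp: U_def \<delta>'_def ok_def)
    then have "z \<in> K e" using connectedD_interval[OF K_conn that(3) mid_K[OF oke]] by auto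
    then show False using z by blast
  qed
  then show ?thesis using that e1 unfolding \<delta>'_def by auto
qed

text \<open>Since \<open>w\<close> has finitely many preimages, the widths and times that witness their failure to be good
could be chosen uniformly, contradicting that \<open>w\<close> is good.\<close>

lemma good_preimage:
  assumes "good w" "w \<in> {a..b}"
  shows "\<exists>v. good v \<and> v \<in> {a..b} \<and> f v = w"
proof (rule ccontr)
  assume "\<nexists>v. good v \<and> v \<in> {a..b} \<and> f v = w"
  then have "\<not> good v" if "v \<in> {a..b}" "f v = w" for v using that by blast
  then have bad: "\<exists>e N. ok e \<and> (\<forall>k\<ge>N. v \<notin> (f ^^ k) ` U e)" if "v \<in> {a..b}" "f v = w" for v
  proof -
    have "\<not> good v" using \<open>\<And>v. v \<in> {a..b} \<Longrightarrow> f v = w \<Longrightarrow> \<not> good v\<close> that by blast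
    then show ?thesis unfolding good_def by blast
  qed
  define A where "A = {v \<in> {a..b}. f v = w}"
  have "inj_on f {a..c}" "inj_on f {c..b}" using ac cb by (auto intro!: inj_side)
  then have "finite (f -` {w} \<inter> {a..c})" "finite (f -` {w} \<inter> {c..b})"
    using finite_vimage_IntI[of "{w}" f "{a..c}"] finite_vimage_IntI[of "{w}" f "{c..b}"] by simp_all
  then have "finite ((f -` {w} \<inter> {a..c}) \<union> (f -` {w} \<inter> {c..b}))" by blast
  then have "finite A" by (rule finite_subset[rotated]) (auto simp: A_def)
  have "\<forall>v\<in>A. \<exists>q. ok (fst q) \<and> (\<forall>k\<ge>snd q. v \<notin> (f ^^ k) ` U (fst q))"
    using bad unfolding A_def by simp
  then obtain F where F: "\<forall>v\<in>A. ok (fst (F v)) \<and> (\<forall>k\<ge>snd (F v). v \<notin> (f ^^ k) ` U (fst (F v)))"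
    by (rule bchoice[THEN exE])
  define E where "E v = fst (F v)" for v
  define N where "N v = snd (F v)" for v
  have EN: "ok (E v)" "k \<ge> N v \<Longrightarrow> v \<notin> (f ^^ k) ` U (E v)" if "v \<in> A" for v k
    using F that by (simp_all add: E_def N_def)
  define e where "e = Min (insert (y - a) (E ` A))"
  define n where "n = Max (insert 0 (N ` A))"
  have "e \<in> insert (y - a) (E ` A)" unfolding e_def using \<open>finite A\<close> by (intro Min_in) auto
  then have "ok e" using EN(1) ok_top by auto
  then obtain k u where k: "k \<ge> Suc n" "u \<in> U e" "w = (f ^^ k) u" using assms(1) unfolding good_def by blast
  define v where "v = (f ^^ (k - 1)) u"
  have "f v = (f ^^ Suc (k - 1)) u" by (simp add: v_def)
  then have "f v = w" using k by simp
  then have vA: "v \<in> A" using k(2) U_sub[OF \<open>ok e\<close>] iter_mem by (auto simp: A_def v_def subset_iff)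
  have "e \<le> E v" unfolding e_def using \<open>finite A\<close> vA by (intro Min_le) auto
  then have "u \<in> U (E v)" using k(2) by (auto simp: U_def)
  moreover have "N v \<le> n" unfolding n_def using \<open>finite A\<close> vA by (intro Max_ge) auto
  then have "N v \<le> k - 1" using k by simp
  ultimately show False using EN(2)[OF vA] v_def by blast
qed

lemma good_orbit:
  obtains s where "backward_orbit {a..b} f x s" "\<And>n. good (s n)"
proof -
  have "\<exists>s. \<forall>n. (good (s n) \<and> s n \<in> {a..b} \<and> (n = 0 \<longrightarrow> s n = x)) \<and> f (s (Suc n)) = s n"
  proof (rule dependent_nat_choice)
    show "\<exists>w. good w \<and> w \<in> {a..b} \<and> (0 = (0::nat) \<longrightarrow> w = x)" using good_x x_mem by blast
    fix w and n :: nat assume "good w \<and> w \<in> {a..b} \<and> (n = 0 \<longrightarrow> w = x)"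
    then show "\<exists>v. (good v \<and> v \<in> {a..b} \<and> (Suc n = 0 \<longrightarrow> v = x)) \<and> f v = w"
      using good_preimage by blast
  qed
  then show ?thesis using that by (auto simp: backward_orbit_def)
qed

text \<open>A backward orbit of good points runs cyclically through the images of every \<open>K e\<close>.\<close>

lemma good_orbit_visits:
  assumes "backward_orbit {a..b} f x s" "\<And>n. good (s n)" "ok e" "j < per e"
  shows "\<exists>n\<ge>N. s n \<in> (f ^^ j) ` K e"
proof -
  obtain i where i: "i < per e" "s N \<in> (f ^^ i) ` K e" using M_pieces good_M assms by blast
  define m where "m = i + per e - j"
  obtain i' where i': "i' < per e" "s (N + m) \<in> (f ^^ i') ` K e" using M_pieces good_M assms by blast
  then obtain u v where uv: "u \<in> K e" "s N = (f ^^ i) u" "v \<in> K e" "s (N + m) = (f ^^ i') v" using i by blast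
  have "(f ^^ (m + i')) v = (f ^^ i) u"
    using backward_orbit_iter[OF assms(1), of m N] uv by (simp only: iter_add)
  then have "(m + i') mod per e = i mod per e"
    using periodic_interval_disjoint[OF K_periodic[OF assms(3)] uv(3,1)] by blast
  moreover have "m + j = i + per e" using assms(4) by (simp add: m_def)
  then have "(m + j) mod per e = i mod per e" by simp
  ultimately have "i' mod per e = j mod per e"
    by - (rule mod_add_left_cancel[of m], simp)
  then have "i' = j" using i' assms(4) by simp
  then show ?thesis using i' by (intro exI[of _ "N + m"]) auto
qed

end

section \<open>Monotone returns and bounded periods\<close>

text \<open>A point to which orbits of an increasing map return is fixed: if \<open>z < g z\<close>, say, then orbits starting
near \<open>z\<close> move up past a neighbourhood of \<open>z\<close> in one step and stay above it.\<close>

lemma return_fixed: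
  fixes g :: "real \<Rightarrow> real"
  assumes mono: "mono_on Z g" and z: "z \<in> Z" and cont: "continuous (at z within Z) g"
    and ret: "\<And>\<eta>. \<eta> > 0 \<Longrightarrow> \<exists>w k. k \<ge> 1 \<and> \<bar>w - z\<bar> < \<eta> \<and> \<bar>(g ^^ k) w - z\<bar> < \<eta> \<and> (\<forall>j\<le>k. (g ^^ j) w \<in> Z)"
  shows "g z = z"
proof (rule ccontr)
  assume ne: "g z \<noteq> z"
  define \<epsilon> where "\<epsilon> = \<bar>g z - z\<bar> / 2"
  have \<epsilon>: "\<epsilon> > 0" using ne by (simp add: \<epsilon>_def)
  then obtain d where d: "d > 0" "\<And>w. w \<in> Z \<Longrightarrow> \<bar>w - z\<bar> < d \<Longrightarrow> \<bar>g w - g z\<bar> < \<epsilon>"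
    using cont unfolding continuous_within_eps_delta dist_real_def by blast
  obtain w k where k: "k \<ge> 1" "\<bar>w - z\<bar> < min d \<epsilon>" "\<bar>(g ^^ k) w - z\<bar> < min d \<epsilon>"
    and Z: "\<And>j. j \<le> k \<Longrightarrow> (g ^^ j) w \<in> Z"
    using ret[of "min d \<epsilon>"] d \<epsilon> by auto
  have wZ: "w \<in> Z" "g w \<in> Z" using Z[of 0] Z[of 1] k by auto
  have gw: "\<bar>g w - g z\<bar> < \<epsilon>" using d(2)[OF wZ(1)] k by simp
  have wz: "\<bar>w - z\<bar> < \<epsilon>" using k by simp
  have kz: "(g ^^ k) w < z + \<epsilon>" "z - \<epsilon> < (g ^^ k) w" using k(3) by auto
  consider "g z > z" | "g z < z" using ne by linarith
  then show False
  proof cases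
    case 1
    then have "2 * \<epsilon> = g z - z" by (simp add: \<epsilon>_def)
    then have big: "g w > z + \<epsilon>" "w < g w"
      using conjunct2[OF gw[unfolded abs_less_iff]] conjunct1[OF gw[unfolded abs_less_iff]] conjunct1[OF wz[unfolded abs_less_iff]] conjunct2[OF wz[unfolded abs_less_iff]]
      by - (linarith, linarith)
    have "j < k \<Longrightarrow> (g ^^ Suc j) w \<ge> g w" for j
    proof (induction j)
      case (Suc j)
      then have "g w \<le> g ((g ^^ Suc j) w)"
        using monotone_onD[OF mono wZ(1) Z[of "Suc j"]] big by force
      then show ?case by simp
    qed simp
    from this[of "k - 1"] show False using k(1) big kz by simp
  next
    case 2
    then have "2 * \<epsilon> = z - g z" by (simp add: \<epsilon>_def)
    then have big: "g w < z - \<epsilon>" "w > g w"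
      using conjunct2[OF gw[unfolded abs_less_iff]] conjunct1[OF gw[unfolded abs_less_iff]] conjunct1[OF wz[unfolded abs_less_iff]] conjunct2[OF wz[unfolded abs_less_iff]]
      by - (linarith, linarith)
    have "j < k \<Longrightarrow> (g ^^ Suc j) w \<le> g w" for j
    proof (induction j)
      case (Suc j)
      then have "g ((g ^^ Suc j) w) \<le> g w"
        using monotone_onD[OF mono Z[of "Suc j"] wZ(1)] big by force
      then show ?case by simp
    qed simp
    from this[of "k - 1"] show False using k(1) big kz by simp
  qed
qed

lemma iter_between_fixed:
  fixes g :: "real \<Rightarrow> real"
  assumes mono: "strict_mono_on Z g" and "{u..v} \<subseteq> Z" "g u = u" "g v = v" "w \<in> {u<..<v}"
  shows "(g ^^ m) w \<in> {u<..<v}"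
proof (induction m)
  case (Suc m)
  let ?w = "(g ^^ m) w"
  have "u \<in> Z" "v \<in> Z" "?w \<in> Z" using Suc assms(2) by (auto simp: subset_iff)
  then have "g u < g ?w" "g ?w < g v" using mono Suc by (auto intro: monotone_onD)
  then show ?case using assms by simp
qed (use assms in simp)

context left_limit
begin

definition orbit_limit :: "real \<Rightarrow> bool" where
  "orbit_limit z \<longleftrightarrow> (\<exists>s. backward_orbit {a..b} f x s \<and> clusters_at s z)"

lemma orbit_limit_seq:
  assumes "\<delta> > 0"
  obtains z where "strict_mono z" "\<And>i::nat. orbit_limit (z i)" "\<And>i. y - \<delta> < z i" "\<And>i. z i < y"
proof -
  have "\<exists>z. \<forall>i. (orbit_limit (z i) \<and> y - \<delta> < z i \<and> z i < y) \<and> z i < z (Suc i)"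
  proof (rule dependent_nat_choice)
    show "\<exists>w. orbit_limit w \<and> y - \<delta> < w \<and> w < y" using accum[OF assms] by (auto simp: orbit_limit_def)
    fix w assume w: "orbit_limit w \<and> y - \<delta> < w \<and> w < y"
    obtain w' where "orbit_limit w'" "y - (y - w) < w'" "w' < y" using accum[of "y - w"] w by (auto simp: orbit_limit_def)
    then show "\<exists>w'. (orbit_limit w' \<and> y - \<delta> < w' \<and> w' < y) \<and> w < w'" using w by auto
  qed
  then show ?thesis using that by (auto simp: strict_mono_Suc_iff)
qed

text \<open>Two disjoint gaps between fixed points of an increasing iterate \<open>f ^^ P\<close> are invariant under it, so points
in them cannot meet at times that agree modulo \<open>P\<close>.\<close>

lemma fixed_gaps_separate:
  assumes mono: "strict_mono_on Z (f ^^ P)" and Z: "{u..v'} \<subseteq> Z" and P: "P > 0"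
    and ord: "u < v" "v \<le> u'" "u' < v'"
    and fixed: "(f ^^ P) u = u" "(f ^^ P) v = v" "(f ^^ P) u' = u'" "(f ^^ P) v' = v'"
    and w: "w \<in> {u<..<v}" "w' \<in> {u'<..<v'}" and eq: "(f ^^ k) w = (f ^^ k') w'"
    and cong: "k mod P = k' mod P"
  shows False
proof -
  let ?g = "f ^^ P"
  define r where "r = k mod P"
  have sub: "{u..v} \<subseteq> Z" "{u'..v'} \<subseteq> Z" using Z ord by auto
  have mem: "(?g ^^ m) w \<in> {u<..<v}" "(?g ^^ m) w' \<in> {u'<..<v'}" for m
    using iter_between_fixed[OF mono] sub fixed w by blast+
  have inj: "inj_on (f ^^ r) Z"
    using inj_iter_le[OF strict_mono_on_imp_inj_on[OF mono], of r] P by (simp add: r_def)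
  have *: "(f ^^ k) v = (f ^^ r) ((?g ^^ (k div P)) v)" if "k mod P = r" for k v
  proof -
    have "(f ^^ k) v = (f ^^ (k mod P + P * (k div P))) v" by simp
    then show ?thesis using that by (simp only: iter_add funpow_mult)
  qed
  have "(f ^^ r) ((?g ^^ (k div P)) w) = (f ^^ r) ((?g ^^ (k' div P)) w')"
    using eq *[of k w] *[of k' w'] cong by (simp add: r_def)
  moreover have "(?g ^^ (k div P)) w \<in> Z" "(?g ^^ (k' div P)) w' \<in> Z"
    using mem[of "k div P"] mem[of "k' div P"] sub by auto
  ultimately have "(?g ^^ (k div P)) w = (?g ^^ (k' div P)) w'" using inj by (auto dest: inj_onD)
  then show False using mem(1)[of "k div P"] mem(2)[of "k' div P"] ord by auto
qed

lemma orbit_to_x: "backward_orbit {a..b} f x s \<Longrightarrow> (f ^^ n) (s n) = x"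
  using backward_orbit_iter[of "{a..b}" f x s n 0] by (simp add: backward_orbit_def)

lemma mod_two_classes:
  fixes k1 k2 k3 p P :: nat
  assumes "P = p \<or> P = 2 * p" "k1 mod p = k2 mod p" "k2 mod p = k3 mod p"
  shows "k1 mod P = k2 mod P \<or> k1 mod P = k3 mod P \<or> k2 mod P = k3 mod P"
proof (cases "P = p")
  case False
  then have P: "P = p * 2" using assms(1) by simp
  have "k mod P = p * (k div p mod 2) + k mod p" for k unfolding P by (rule mod_mult2_eq)
  moreover have "l1 mod 2 = l2 mod 2 \<or> l1 mod 2 = l3 mod 2 \<or> l2 mod 2 = l3 mod 2" for l1 l2 l3 :: nat
    by (simp add: mod2_eq_if)
  from this[of "k1 div p" "k2 div p" "k3 div p"]
  have "k1 div p mod 2 = k2 div p mod 2 \<or> k1 div p mod 2 = k3 div p mod 2 \<or> k2 div p mod 2 = k3 div p mod 2" .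
  ultimately show ?thesis using assms(2,3) by auto
qed (use assms in simp)

text \<open>Seven cluster points \<open>z 0 < \<dots> < z 6\<close> are fixed and bound three gaps, each of which contains
a point of a backward orbit of \<open>x\<close>. All three hit \<open>x\<close> at times congruent modulo \<open>per e\<close>, hence
two of them at times congruent modulo \<open>2 * per e\<close>.\<close>

lemma no_monotone_returns:
  assumes e: "ok e" and P: "P = per e \<or> P = 2 * per e"
    and Z: "Z \<subseteq> K e" "connected Z" and mono: "strict_mono_on Z (f ^^ P)"
    and z: "strict_mono z" "\<And>i::nat. i \<le> 6 \<Longrightarrow> orbit_limit (z i)" "z 0 \<in> Z" "z 6 \<in> Z"
    and ret: "\<And>i \<eta>. i \<le> 6 \<Longrightarrow> \<eta> > 0 \<Longrightarrow> \<exists>w k. k \<ge> 1 \<and> \<bar>w - z i\<bar> < \<eta> \<and> \<bar>(f ^^ (P * k)) w - z i\<bar> < \<eta> \<and>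
       (\<forall>j\<le>k. (f ^^ (P * j)) w \<in> Z)"
  shows False
proof -
  note KP = K_periodic[OF e]
  have P0: "P > 0" using P per_prop(1)[OF e] by auto
  have seg: "{z 0..z 6} \<subseteq> Z" using connectedD_interval[OF Z(2) z(3,4)] by auto
  have zmono: "z i \<le> z j" if "i \<le> j" for i j using z(1) that by (simp add: strict_mono_less_eq)
  have zlt: "z i < z j" if "i < j" for i j using z(1) that by (simp add: strict_mono_less)
  have zZ: "z i \<in> Z" if "i \<le> 6" for i using seg zmono[of 0 i] zmono[of i 6] that by auto
  have fixed: "(f ^^ P) (z i) = z i" if i: "i \<le> 6" for i
  proof (rule return_fixed)
    show "mono_on Z (f ^^ P)" using mono by (rule strict_mono_on_imp_mono_on)
    show "continuous (at (z i) within Z) (f ^^ P)"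
      using continuous_on_subset[OF cont_iter, of Z P] Z(1) K_sub[OF e] zZ[OF i]
      by (auto simp: continuous_on_eq_continuous_within)
  qed (use ret[OF i] zZ[OF i] in \<open>auto simp: funpow_mult\<close>)
  have gap: "\<exists>w k. w \<in> {z i<..<z (i + 2)} \<and> (f ^^ k) w = x" if i: "i \<le> 4" for i
  proof -
    obtain s where s: "backward_orbit {a..b} f x s" "clusters_at s (z (Suc i))"
      using z(2)[of "Suc i"] i by (auto simp: orbit_limit_def)
    have "z (Suc i) \<in> {z i<..<z (i + 2)}" using zlt by simp
    then obtain n where "s n \<in> {z i<..<z (i + 2)}" using visits[OF s(2) _ open_greaterThanLessThan] by blast
    then show ?thesis using orbit_to_x[OF s(1)] by blast
  qed
  obtain w1 k1 where 1: "w1 \<in> {z 0<..<z 2}" "(f ^^ k1) w1 = x" using gap[of 0] by (auto simp: numeral_eq_Suc)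
  obtain w2 k2 where 2: "w2 \<in> {z 2<..<z 4}" "(f ^^ k2) w2 = x" using gap[of 2] by auto
  obtain w3 k3 where 3: "w3 \<in> {z 4<..<z 6}" "(f ^^ k3) w3 = x" using gap[of 4] by auto
  have inK: "w \<in> K e" if "w \<in> {z i<..<z j}" "i \<le> 6" "j \<le> 6" for w i j
  proof -
    have "w \<in> {z 0..z 6}" using that zmono[of 0 i] zmono[of j 6] by simp
    then show ?thesis using seg Z(1) by blast
  qed
  have "k1 mod per e = k2 mod per e" "k2 mod per e = k3 mod per e"
    using periodic_interval_disjoint[OF KP inK[OF 1(1)] inK[OF 2(1)], of k1 k2]
      periodic_interval_disjoint[OF KP inK[OF 2(1)] inK[OF 3(1)], of k2 k3] 1 2 3 by auto
  from mod_two_classes[OF P this]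
  consider "k1 mod P = k2 mod P" | "k1 mod P = k3 mod P" | "k2 mod P = k3 mod P" by blast
  then show False
  proof cases
    case 1
    show False
      by (rule fixed_gaps_separate[OF mono _ P0 zlt[of 0 2] zmono[of 2 2] zlt[of 2 4] _ _ _ _ \<open>w1 \<in> _\<close> \<open>w2 \<in> _\<close> _ 1])
        (use seg zmono[of 4 6] fixed \<open>(f ^^ k1) w1 = x\<close> \<open>(f ^^ k2) w2 = x\<close> in auto)
  next
    case 2
    show False
      by (rule fixed_gaps_separate[OF mono _ P0 zlt[of 0 2] zmono[of 2 4] zlt[of 4 6] _ _ _ _ \<open>w1 \<in> _\<close> \<open>w3 \<in> _\<close> _ 2])
        (use seg fixed \<open>(f ^^ k1) w1 = x\<close> \<open>(f ^^ k3) w3 = x\<close> in auto)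
  next
    case 3
    show False
      by (rule fixed_gaps_separate[OF mono _ P0 zlt[of 2 4] zmono[of 4 4] zlt[of 4 6] _ _ _ _ \<open>w2 \<in> _\<close> \<open>w3 \<in> _\<close> _ 3])
        (use seg zmono[of 0 2] fixed \<open>(f ^^ k2) w2 = x\<close> \<open>(f ^^ k3) w3 = x\<close> in auto)
  qed
qed

text \<open>Otherwise all iterates would be injective on \<open>K e\<close>, and the square of the return map increasing.\<close>

lemma c_in_M:
  assumes e: "ok e"
  shows "c \<in> M e"
proof (rule ccontr)
  assume nc: "c \<notin> M e"
  let ?p = "per e"
  have inj: "inj_on (f ^^ k) (K e)" for k
    using K_sub[OF e] K_conn K_M M_iter nc by (intro inj_iter) blast+
  have fK: "(f ^^ ?p) u \<in> K e" if "u \<in> K e" for u using per_prop(2)[OF e] that by blast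
  have mono: "strict_mono_on (K e) (f ^^ (2 * ?p))"
  proof -
    have "(f ^^ (2 * ?p)) u = (f ^^ ?p) ((f ^^ ?p) u)" for u by (simp add: mult_2 iter_add)
    then show ?thesis using mono_or_anti[OF K_sub[OF e] K_conn inj[of ?p]] fK
      by (auto simp: monotone_on_def)
  qed
  obtain z where z: "strict_mono z" "\<And>i::nat. orbit_limit (z i)" "\<And>i. y - e < z i" "\<And>i. z i < y"
    using orbit_limit_seq[of e] e by (auto simp: ok_def)
  have zU: "z i \<in> U e" for i using z by (simp add: U_def)
  show False
  proof (rule no_monotone_returns[OF e _ order_refl K_conn mono z(1)])
    fix i :: nat and \<eta> :: real assume "\<eta> > 0"
    define V where "V = {z i - \<eta><..<z i + \<eta>} \<inter> U e"
    obtain s where s: "backward_orbit {a..b} f x s" "clusters_at s (z i)" using z(2) by (auto simp: orbit_limit_def)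
    have V: "z i \<in> V" "open V" using zU \<open>\<eta> > 0\<close> by (auto simp: V_def U_def)
    have VK: "V \<subseteq> K e" using U_K[OF e] by (auto simp: V_def)
    obtain n1 where n1: "s n1 \<in> V" using visits[OF s(2) V] by blast
    obtain n2 where n2: "n2 \<ge> Suc n1" "s n2 \<in> V" using visits[OF s(2) V] by blast
    obtain n3 where n3: "n3 \<ge> Suc n2" "s n3 \<in> V" using visits[OF s(2) V] by blast
    have dv: "?p dvd m - n" if "n \<le> m" "s n \<in> V" "s m \<in> V" for n m
      using periodic_interval_return[OF K_periodic[OF e], of "s m" "m - n"] that VK
        backward_orbit_iter_le[OF s(1) that(1)] by auto
    obtain q1 q2 where q: "n2 - n1 = ?p * q1" "n3 - n2 = ?p * q2" using dv n1 n2 n3 by (meson Suc_leD dvdE)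
    \<comment> \<open>Among three visits two are separated by an even multiple of the period.\<close>
    have "n3 - n1 = ?p * (q1 + q2)" using q n2 n3 by (simp add: distrib_left)
    moreover have "even q1 \<or> even q2 \<or> even (q1 + q2)" by auto
    ultimately have "\<exists>n m. n < m \<and> s n \<in> V \<and> s m \<in> V \<and> 2 * ?p dvd m - n"
    proof (elim disjE)
      assume "even q1" then show ?thesis using q n1 n2 by (intro exI[of _ n1] exI[of _ n2]) (auto elim!: evenE)
    next
      assume "even q2" then show ?thesis using q n2 n3 by (intro exI[of _ n2] exI[of _ n3]) (auto elim!: evenE)
    next
      assume "even (q1 + q2)" "n3 - n1 = ?p * (q1 + q2)"
      then show ?thesis using n1 n2 n3 by (intro exI[of _ n1] exI[of _ n3]) (auto elim!: evenE)
    qed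
    then obtain n m k where nm: "n < m" "s n \<in> V" "s m \<in> V" "m - n = 2 * ?p * k" by (auto elim!: dvdE)
    then have "k \<ge> 1" by (cases k) auto
    moreover have "(f ^^ (2 * ?p * k)) (s m) = s n" using backward_orbit_iter_le[OF s(1), of n m] nm by simp
    moreover have "(f ^^ (2 * ?p * j)) (s m) \<in> K e" for j
      using periodic_interval_dvd[OF K_periodic[OF e], of "2 * ?p * j" "s m"] nm(3) VK by auto
    ultimately show "\<exists>w k. k \<ge> 1 \<and> \<bar>w - z i\<bar> < \<eta> \<and> \<bar>(f ^^ (2 * ?p * k)) w - z i\<bar> < \<eta> \<and>
       (\<forall>j\<le>k. (f ^^ (2 * ?p * j)) w \<in> K e)"
      using nm by (intro exI[of _ "s m"] exI[of _ k]) (auto simp: V_def)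
  qed (use z(2) zU U_K[OF e] in auto)
qed

text \<open>If \<open>e \<le> e1\<close>, the turning point \<open>d\<close> of the return map \<open>f ^^ per e1\<close> of \<open>K e1\<close> belongs to an image of \<open>K e\<close>
under an iterate of that map.\<close>

lemma turning_point:
  assumes e1: "ok e1" and e: "0 < e" "e \<le> e1"
    and d: "d \<in> K e1" "i < per e1" "(f ^^ i) d = c"
  shows "\<exists>u. i + u * per e1 < per e \<and> d \<in> (f ^^ (u * per e1)) ` K e"
proof -
  have oke: "ok e" using ok_le e e1 by blast
  obtain j v where j: "j < per e" "v \<in> K e" "c = (f ^^ j) v"
    using M_pieces[OF oke c_in_M[OF oke]] by blast
  have v1: "v \<in> K e1" using K_mono[OF e1 e] j by blast
  have m: "j mod per e1 = i mod per e1"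
    using periodic_interval_disjoint[OF K_periodic[OF e1] v1 d(1), of j i] j(3) d(3) by simp
  then have "j mod per e1 = i" using d by simp
  then have ji: "j = i + (j div per e1) * per e1" by (metis add.commute div_mult_mod_eq)
  define u where "u = j div per e1"
  have "(f ^^ (u * per e1)) v \<in> K e1" using periodic_interval_dvd[OF K_periodic[OF e1] _ v1] by simp
  moreover have "(f ^^ i) ((f ^^ (u * per e1)) v) = (f ^^ i) d"
    using j d ji by (simp add: u_def flip: iter_add)
  moreover have "inj_on (f ^^ i) (K e1)" using inj_iter_before_c[OF K_periodic[OF e1] d(2,1,3)] .
  ultimately have "d = (f ^^ (u * per e1)) v" using d(1) by (auto dest: inj_onD)
  then show ?thesis using ji j u_def by (intro exI[of _ u]) auto
qed

lemma turning_point_exists: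
  assumes "ok e"
  obtains d i where "d \<in> K e" "i < per e" "(f ^^ i) d = c"
  using M_pieces[OF assms c_in_M[OF assms]] by blast

text \<open>If the period were constant below \<open>e1\<close>, a much smaller \<open>K e2\<close>, lying to the right of several cluster points,
would be invariant under the same return map \<open>g\<close> and contain both its turning point \<open>d\<close> and \<open>g d\<close>. If \<open>g d\<close> is the
minimum of \<open>g\<close>, the points of \<open>K e1\<close> to the left of \<open>K e2\<close> have no preimage in \<open>K e1\<close>. If it is the maximum,
orbits that return to the left of \<open>K e2\<close> never leave the increasing branch of \<open>g\<close>.\<close>

lemma period_unbounded:
  assumes e1: "ok e1"
  shows "\<exists>e. 0 < e \<and> e \<le> e1 \<and> per e \<noteq> per e1"
proof (rule ccontr)
  assume "\<nexists>e. 0 < e \<and> e \<le> e1 \<and> per e \<noteq> per e1"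
  then have const: "\<And>e. 0 < e \<Longrightarrow> e \<le> e1 \<Longrightarrow> per e = per e1" by blast
  let ?p = "per e1" let ?g = "f ^^ per e1"
  note K1 = K_periodic[OF e1]
  have p0: "?p > 0" using per_prop(1)[OF e1] by simp
  obtain z where z: "strict_mono z" "\<And>i::nat. orbit_limit (z i)" "\<And>i. y - e1 < z i" "\<And>i. z i < y"
    using orbit_limit_seq[of e1] e1 by (auto simp: ok_def)
  have zmono: "z i \<le> z j" if "i \<le> j" for i j using z(1) that by (simp add: strict_mono_less_eq)
  define \<zeta> where "\<zeta> = (z 6 + y) / 2"
  have \<zeta>: "z 6 < \<zeta>" "\<zeta> < y" using z(4)[of 6] by (auto simp: \<zeta>_def)
  obtain e2' where e2': "ok e2'" "\<And>e u. 0 < e \<Longrightarrow> e \<le> e2' \<Longrightarrow> u \<in> K e \<Longrightarrow> y - (y - \<zeta>) < u"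
    using K_left_end[of "y - \<zeta>"] \<zeta>(2) by (metis diff_gt_0_iff_gt)
  define e2 where "e2 = min e1 e2'"
  have e2: "0 < e2" "e2 \<le> e1" "ok e2" using e1 e2' by (auto simp: e2_def ok_def)
  have K2: "\<zeta> < u" if "u \<in> K e2" for u using e2'(2)[OF e2(1) _ that] by (simp add: e2_def)
  have p2: "per e2 = ?p" using const e2 by blast
  note K2p = K_periodic[OF e2(3), unfolded p2]
  obtain d i where d: "d \<in> K e2" "i < ?p" "(f ^^ i) d = c" using turning_point_exists[OF e2(3)] p2 by metis
  have K21: "K e2 \<subseteq> K e1" using K_mono[OF e1 e2(1,2)] .
  have d1: "d \<in> K e1" using d K21 by blast
  have gd: "?g d \<in> K e2" using periodic_interval_dvd[OF K2p _ d(1)] by simp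
  define B where "B = {y - e1<..<\<zeta>}"
  have BU: "B \<subseteq> K e1" using U_K[OF e1] \<zeta> by (auto simp: B_def U_def)
  have zB: "z i \<in> B" if "i \<le> 6" for i using z(3) zmono[OF that] \<zeta> by (auto simp: B_def intro: le_less_trans)
  have returns: "\<exists>n m k. k \<ge> 1 \<and> s n \<in> V \<and> s m \<in> V \<and> (f ^^ (?p * k)) (s m) = s n"
    if s: "backward_orbit {a..b} f x s" "clusters_at s w" and V: "w \<in> V" "open V" "V \<subseteq> B" for s w V
  proof -
    obtain n where n: "s n \<in> V" using visits[OF s(2) V(1,2)] by blast
    obtain m where m: "m \<ge> Suc n" "s m \<in> V" using visits[OF s(2) V(1,2)] by blast
    have it: "(f ^^ (m - n)) (s m) = s n" using backward_orbit_iter_le[OF s(1), of n m] m by simp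
    then have "?p dvd m - n" using periodic_interval_return[OF K1, of "s m" "m - n"] n m V BU by auto
    then obtain k where k: "m - n = ?p * k" by blast
    then have "k \<ge> 1" using m by (cases k) auto
    then show ?thesis using n m it k by metis
  qed
  consider (max) "\<forall>z\<in>K e1. ?g z \<le> ?g d" "strict_mono_on (K e1 \<inter> {..d}) ?g"
    | (min) "\<forall>z\<in>K e1. ?g d \<le> ?g z"
    using iter_turning_point[OF K1 d(2) d1 d(3)] by blast
  then show False
  proof cases
    case min
    obtain s where s: "backward_orbit {a..b} f x s" "clusters_at s (z 0)" using z(2) by (auto simp: orbit_limit_def)
    obtain n m k where k: "k \<ge> 1" "s n \<in> B" "s m \<in> B" "(f ^^ (?p * k)) (s m) = s n"
      using returns[OF s zB] by (auto simp: B_def)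
    define v where "v = (f ^^ (?p * (k - 1))) (s m)"
    have "v \<in> K e1" using periodic_interval_dvd[OF K1, of "?p * (k - 1)" "s m"] k BU by (auto simp: v_def)
    moreover have "?g v = s n"
    proof -
      have "?p * k = ?p + ?p * (k - 1)" using k(1) by (cases k) auto
      then show ?thesis using k(4) unfolding v_def by (metis iter_add)
    qed
    ultimately have "?g d \<le> s n" using min by metis
    then show False using K2[OF gd] k(2) by (auto simp: B_def)
  next
    case max
    define Z where "Z = K e1 \<inter> {..<d}"
    have dB: "\<zeta> < d" using K2 d by blast
    show False
    proof (rule no_monotone_returns[OF e1 _ _ _ _ z(1)])
      show "?p = per e1 \<or> ?p = 2 * per e1" by simp
      show "strict_mono_on Z ?g" using max(2) by (rule monotone_on_subset) (auto simp: Z_def)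
      show "connected Z" unfolding Z_def
        using K_conn[of e1] by (auto simp: connected_iff_interval intro!: is_interval_connected_1)
      show "z 0 \<in> Z" "z 6 \<in> Z" using zB[of 0] zB[of 6] BU dB by (auto simp: Z_def B_def)
      fix i :: nat and \<eta> :: real assume i: "i \<le> 6" and "\<eta> > 0"
      obtain s where s: "backward_orbit {a..b} f x s" "clusters_at s (z i)" using z(2) by (auto simp: orbit_limit_def)
      define V where "V = {z i - \<eta><..<z i + \<eta>} \<inter> B"
      have V: "z i \<in> V" "open V" "V \<subseteq> B" using zB[OF i] \<open>\<eta> > 0\<close> by (auto simp: V_def B_def)
      obtain n m k where k: "k \<ge> 1" "s n \<in> V" "s m \<in> V" "(f ^^ (?p * k)) (s m) = s n"
        using returns[OF s V] by blast
      have "(f ^^ (?p * j)) (s m) \<in> Z" if j: "j \<le> k" for j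
      proof -
        let ?w = "(f ^^ (?p * j)) (s m)"
        have wK: "?w \<in> K e1" using periodic_interval_dvd[OF K1, of "?p * j" "s m"] k V BU by auto
        have "?w \<notin> K e2"
        proof
          assume "?w \<in> K e2"
          then have "(f ^^ (?p * (k - j))) ?w \<in> K e2" using periodic_interval_dvd[OF K2p] by simp
          moreover have "?p * (k - j) + ?p * j = ?p * k" using j by (simp flip: distrib_left)
          ultimately have "s n \<in> K e2" using k(4) by (metis iter_add)
          then show False using K2 k(2) V by (fastforce simp: B_def)
        qed
        moreover have "?w \<le> d \<or> ?w \<le> ?g d"
        proof (cases j)
          case 0
          then show ?thesis using k(3) V dB by (auto simp: B_def)
        next
          case (Suc j')
          have "(f ^^ (?p * j')) (s m) \<in> K e1" using periodic_interval_dvd[OF K1, of "?p * j'" "s m"] k V BU by auto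
          moreover have "?w = ?g ((f ^^ (?p * j')) (s m))" by (simp add: Suc iter_add)
          ultimately show ?thesis using max(1) by simp
        qed
        ultimately have "?w < d"
          using connectedD_interval[OF K_conn d(1) gd, of ?w] d(1) by (metis leI order_antisym)
        then show ?thesis using wK by (simp add: Z_def)
      qed
      then show "\<exists>w k. k \<ge> 1 \<and> \<bar>w - z i\<bar> < \<eta> \<and> \<bar>(f ^^ (?p * k)) w - z i\<bar> < \<eta> \<and>
         (\<forall>j\<le>k. (f ^^ (?p * j)) w \<in> Z)"
        using k by (intro exI[of _ "s m"] exI[of _ k]) (auto simp: V_def)
    qed (use z(2) in \<open>auto simp: Z_def\<close>)
  qed
qed

end

section \<open>Wandering intervals around the turning point\<close>

context unimodal
begin

lemma L_nonneg: "0 \<le> L"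
proof -
  have "0 \<le> L * \<bar>a - b\<bar>" using lipschitz[of a b] ac cb by (intro order_trans[OF abs_ge_zero]) auto
  then show ?thesis using ac cb by (simp add: zero_le_mult_iff)
qed

lemma deriv_bounded_below:
  assumes "\<rho> > 0"
  obtains m where "m > 0" "\<And>z. z \<in> {a..b} \<Longrightarrow> \<rho> \<le> \<bar>z - c\<bar> \<Longrightarrow> m \<le> \<bar>f' z\<bar>"
proof -
  let ?T = "{a..b} - ball c \<rho>"
  have T: "z \<in> ?T \<longleftrightarrow> z \<in> {a..b} \<and> \<rho> \<le> \<bar>z - c\<bar>" for z
    by (auto simp: dist_real_def abs_minus_commute)
  have "continuous_on {a..b} f'"
    by (rule lipschitz_on_continuous_on[of L]) (use lipschitz L_nonneg in \<open>auto simp: lipschitz_on_def dist_real_def\<close>)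
  then have cont': "continuous_on ?T (\<lambda>z. \<bar>f' z\<bar>)"
    by (intro continuous_on_rabs) (auto elim: continuous_on_subset)
  show ?thesis
  proof (cases "?T = {}")
    case True
    then have "\<not> (z \<in> {a..b} \<and> \<rho> \<le> \<bar>z - c\<bar>)" for z using T by blast
    then show ?thesis using that[of 1] by auto
  next
    case False
    have "compact ?T" by (intro compact_diff) auto
    then obtain z0 where z0: "z0 \<in> ?T" "\<And>z. z \<in> ?T \<Longrightarrow> \<bar>f' z0\<bar> \<le> \<bar>f' z\<bar>"
      using continuous_attains_inf[OF _ False cont'] by blast
    have "f' z0 \<noteq> 0" using crit[of z0] z0(1) assms by auto
    then show ?thesis using that[of "\<bar>f' z0\<bar>"] z0(2) T by auto
  qed
qed

lemma periodic_interval_image: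
  assumes "periodic_interval K p"
  shows "periodic_interval ((f ^^ k) ` K) p"
  unfolding periodic_interval_def
proof (intro conjI allI impI)
  note KD = periodic_intervalD[OF assms]
  show "(f ^^ k) ` K \<subseteq> {a..b}" "(f ^^ k) ` K \<noteq> {}" "connected ((f ^^ k) ` K)" "1 \<le> p"
    using KD iter_sub connected_iter by auto
  show "(f ^^ p) ` (f ^^ k) ` K \<subseteq> (f ^^ k) ` K"
  proof -
    have "(f ^^ p) ((f ^^ k) u) = (f ^^ k) ((f ^^ p) u)" for u
      by (metis add.commute iter_add)
    then show ?thesis using KD(6) by auto
  qed
  fix i j assume "(f ^^ i) ` (f ^^ k) ` K \<inter> (f ^^ j) ` (f ^^ k) ` K \<noteq> {}"
  then obtain u v where uv: "u \<in> K" "v \<in> K" "(f ^^ (i + k)) u = (f ^^ (j + k)) v"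
    by (auto simp: iter_add)
  then have "(k + i) mod p = (k + j) mod p"
    using periodic_interval_disjoint[OF assms uv] by (simp add: add.commute)
  then show "i mod p = j mod p" by (rule mod_add_left_cancel)
qed

text \<open>Nested intervals around \<open>c\<close> whose images under one iterate keep a definite length do not shrink to \<open>c\<close>.\<close>

lemma nested_common_point:
  assumes C: "\<And>n. connected (C n)" "\<And>n. C n \<subseteq> {a..b}" "\<And>n. c \<in> C n" "\<And>n::nat. C (Suc n) \<subseteq> C n"
    and h: "h > 0" "\<And>n. \<exists>u\<in>C n. \<exists>v\<in>C n. h \<le> \<bar>(f ^^ S) u - (f ^^ S) v\<bar>"
  shows "\<exists>d. d \<noteq> c \<and> (\<forall>n. d \<in> C n)"
proof -
  obtain \<delta> where \<delta>: "\<delta> > 0" "\<And>u v. u \<in> {a..b} \<Longrightarrow> v \<in> {a..b} \<Longrightarrow> \<bar>u - v\<bar> < \<delta> \<Longrightarrow> \<bar>(f ^^ S) u - (f ^^ S) v\<bar> < h"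
    using compact_uniformly_continuous[OF cont_iter[of S] compact_Icc] h(1)
    unfolding uniformly_continuous_on_def dist_real_def by (metis abs_minus_commute)
  have side: "c + \<delta> / 2 \<in> C n \<or> c - \<delta> / 2 \<in> C n" for n
  proof -
    obtain u v where uv: "u \<in> C n" "v \<in> C n" "h \<le> \<bar>(f ^^ S) u - (f ^^ S) v\<bar>" using h(2) by blast
    have "\<delta> \<le> \<bar>u - v\<bar>" using \<delta>(2)[of u v] uv C(2) by (meson not_le subsetD)
    then have "\<delta> / 2 \<le> \<bar>u - c\<bar> \<or> \<delta> / 2 \<le> \<bar>v - c\<bar>" by linarith
    then obtain w where w: "w \<in> C n" "\<delta> / 2 \<le> \<bar>w - c\<bar>" using uv by blast
    then show ?thesis
      using connectedD_interval[OF C(1) C(3) w(1), of "c + \<delta> / 2"] connectedD_interval[OF C(1) w(1) C(3), of "c - \<delta> / 2"] \<delta>(1)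
      by (auto simp: abs_if split: if_splits)
  qed
  have anti: "C m \<subseteq> C n" if "n \<le> m" for n m using C(4) that by (rule lift_Suc_antimono_le)
  have "(\<forall>n. c + \<delta> / 2 \<in> C n) \<or> (\<forall>n. c - \<delta> / 2 \<in> C n)"
  proof (rule ccontr)
    assume "\<not> ?thesis"
    then obtain n m where "c + \<delta> / 2 \<notin> C n" "c - \<delta> / 2 \<notin> C m" by blast
    then show False using side[of "max n m"] anti[of n "max n m"] anti[of m "max n m"] by auto
  qed
  moreover have "c + \<delta> / 2 \<noteq> c" "c - \<delta> / 2 \<noteq> c" using \<delta>(1) by auto
  ultimately show ?thesis by blast
qed

text \<open>The Denjoy-type argument, for a maximum at \<open>c\<close>. The interval \<open>I = (q, f c]\<close> is contained in all \<open>f ` C n\<close>,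
so its images are disjoint and avoid a neighbourhood of \<open>c\<close>. Their lengths are summable, so
the ratio of \<open>\<bar>f ^^ j z - f ^^ j q\<bar>\<close> to the length of \<open>f ^^ j ` I\<close> stays bounded for \<open>z\<close> slightly
to the left of \<open>q\<close>. The images \<open>f ^^ P n ` I\<close> accumulate at \<open>q\<close> from the left, so some \<open>f ^^ P n\<close> maps a
neighbourhood of \<open>q\<close> into itself and has a fixed point there. The contraction forces this fixed point to be \<open>q\<close>, and
then the images of \<open>I\<close> under \<open>f ^^ P n\<close> and its square overlap to the left of \<open>q\<close>.\<close>

lemma no_wandering_turning_interval_max:
  assumes mx: "\<forall>x\<in>{a..b}. f x \<le> f c"
    and C: "\<And>n. periodic_interval (C n) (P n)" "\<And>n. c \<in> C n" "\<And>n::nat. C (Suc n) \<subseteq> C n"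
    and P: "strict_mono P" "\<And>n. P n dvd P (Suc n)"
    and d: "d \<noteq> c" "\<And>n. d \<in> C n"
  shows False
proof -
  have Csub: "C n \<subseteq> {a..b}" for n using periodic_intervalD[OF C(1)] by blast
  have Cconn: "connected (f ` C n)" for n
    using connected_iter[of "C n" 1] periodic_intervalD[OF C(1)] by simp
  have anti: "C m \<subseteq> C n" if "n \<le> m" for n m using C(3) that by (rule lift_Suc_antimono_le)
  have Pge: "n \<le> P n" for n using seq_suble[OF P(1)] .
  have P1: "P n \<ge> 1" for n using periodic_intervalD[OF C(1)] by blast
  have Pdvd: "P n dvd P m" if "n \<le> m" for n m
    using that
  proof (induction rule: dec_induct)
    case (step k)
    then show ?case using dvd_trans[OF _ P(2)[of k]] by blast
  qed simp
  define m where "m n = Inf (f ` C n)" for n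
  define q where "q = (SUP n. m n)"
  let ?t = "f c"
  have fC: "f u \<in> {a..b}" if "u \<in> C n" for u n using f_mem Csub that by blast
  have bdd: "bdd_below (f ` C n)" for n using fC by (intro bdd_belowI[of _ a]) auto
  have m_le: "m n \<le> f u" if "u \<in> C n" for n u unfolding m_def using bdd that by (intro cInf_lower) auto
  have m_ge: "a \<le> m n" for n unfolding m_def using C(2) fC by (intro cInf_greatest) auto
  have bddm: "bdd_above (range m)" using m_le[OF d(2)] by (intro bdd_aboveI[of _ "f d"]) auto
  have m_q: "m n \<le> q" for n unfolding q_def using bddm by (intro cSUP_upper) auto
  have q_d: "q \<le> f d" unfolding q_def using m_le[OF d(2)] by (intro cSUP_least) auto
  have m_mono: "m n \<le> m k" if "n \<le> k" for n k
    unfolding m_def using anti[OF that] bdd C(2) by (intro cInf_superset_mono) auto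
  have q_approx: "\<exists>n0. \<forall>n\<ge>n0. q - \<theta> < m n" if "\<theta> > 0" for \<theta>
  proof -
    have "q - \<theta> < (SUP n. m n)" using that by (simp add: q_def)
    then obtain n0 where "q - \<theta> < m n0" using less_cSUP_iff[OF _ bddm] by auto
    then show ?thesis using m_mono by (meson less_le_trans)
  qed
  have "f d < ?t"
  proof -
    have dab: "d \<in> {a..b}" using d Csub by blast
    then have "inj_on f {min c d..max c d}"
      using c_mem by (intro inj_side) auto
    then have "f d \<noteq> ?t" using d(1) by (auto dest: inj_onD)
    then show ?thesis using mx dab by force
  qed
  then have qt: "q < ?t" using q_d by simp
  have q_mem: "q \<in> {a..b}" using m_ge[of 0] m_q[of 0] q_d fC[OF d(2)] by force
  have t_mem: "?t \<in> {a..b}" using f_mem c_mem by blast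
  define I where "I = {q<..?t}"
  have I_sub: "I \<subseteq> {a..b}" using q_mem t_mem by (auto simp: I_def)
  have I_C: "s \<in> f ` C n" if "s \<in> I" for s n
  proof -
    have "m n < s" using that m_q[of n] by (auto simp: I_def)
    then obtain u where u: "u \<in> C n" "f u < s" unfolding m_def using cInf_lessD[of "f ` C n" s] C(2) by blast
    have "s \<in> {f u..?t}" using u that by (auto simp: I_def)
    then show ?thesis using connectedD_interval[OF Cconn, of "f u" n ?t s] u(1) C(2) by auto
  qed
  have I_disj: "i = j" if "s \<in> I" "s' \<in> I" "(f ^^ i) s = (f ^^ j) s'" for i j s s'
  proof -
    define n where "n = Suc (Suc (max i j))"
    obtain u v where uv: "u \<in> C n" "s = f u" "v \<in> C n" "s' = f v"
      using I_C[OF \<open>s \<in> I\<close>, of n] I_C[OF \<open>s' \<in> I\<close>, of n] by blast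
    have "(f ^^ Suc i) u = (f ^^ Suc j) v" using that(3) uv by (simp add: funpow_swap1)
    then have "Suc i mod P n = Suc j mod P n" using periodic_interval_disjoint[OF C(1) uv(1,3)] by blast
    moreover have "Suc i < P n" "Suc j < P n" using Pge[of n] by (auto simp: n_def)
    ultimately show ?thesis by simp
  qed
  have I_below: "(f ^^ Suc j) s \<le> q" if "s \<in> I" for s j
  proof (rule ccontr)
    assume "\<not> ?thesis"
    moreover have "(f ^^ j) s \<in> {a..b}" using iter_mem that I_sub by blast
    ultimately have "(f ^^ Suc j) s \<in> I" using mx by (auto simp: I_def)
    then show False using I_disj[OF that, of _ "Suc j" 0] by auto
  qed
  have q_below: "(f ^^ Suc j) q \<le> q" for j
  proof (rule ccontr)
    assume "\<not> ?thesis"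
    then have "0 < (f ^^ Suc j) q - q" by simp
    then obtain \<delta> where \<delta>: "\<delta> > 0" "\<And>s. s \<in> {a..b} \<Longrightarrow> \<bar>s - q\<bar> < \<delta> \<Longrightarrow> \<bar>(f ^^ Suc j) s - (f ^^ Suc j) q\<bar> < (f ^^ Suc j) q - q"
      using cont_iter[of "Suc j"] q_mem unfolding continuous_on_iff dist_real_def by meson
    define s where "s = min ?t (q + \<delta> / 2)"
    have "s \<in> I" "\<bar>s - q\<bar> < \<delta>" using qt \<delta>(1) by (auto simp: s_def I_def)
    then have "q < (f ^^ Suc j) s" using \<delta>(2)[of s] I_sub by (auto simp del: funpow.simps)
    then show False using I_below[OF \<open>s \<in> I\<close>, of j] by simp
  qed
  have below: "(f ^^ Suc j) s \<le> q" if "s \<in> {q..?t}" for s j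
    using that I_below[of s j] q_below[of j] by (cases "s = q") (auto simp: I_def simp del: funpow.simps)
  have cl_sub: "{q..?t} \<subseteq> {a..b}" using q_mem t_mem by auto
  obtain \<rho> where \<rho>: "\<rho> > 0" "\<And>z. z \<in> {a..b} \<Longrightarrow> \<bar>z - c\<bar> < \<rho> \<Longrightarrow> q < f z"
  proof -
    have "0 < ?t - q" using qt by simp
    then obtain \<rho> where "\<rho> > 0" "\<And>z. z \<in> {a..b} \<Longrightarrow> \<bar>z - c\<bar> < \<rho> \<Longrightarrow> \<bar>f z - ?t\<bar> < ?t - q"
      using cont c_mem unfolding continuous_on_iff dist_real_def by meson
    then show ?thesis using that[of \<rho>] by (smt (verit))
  qed
  have far: "\<rho> \<le> \<bar>(f ^^ j) s - c\<bar>" if "s \<in> {q..?t}" for s j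
    using \<rho>(2)[of "(f ^^ j) s"] below[OF that, of j] iter_mem cl_sub that by fastforce
  have inj: "inj_on (f ^^ j) {q..?t}" for j
  proof (rule inj_iter[OF cl_sub])
    show "c \<notin> (f ^^ i) ` {q..?t}" for i using far[of _ i] \<rho>(1) by fastforce
  qed simp
  \<comment> \<open>\<open>Q j\<close> and \<open>W j\<close> are the endpoints of the \<open>j\<close>-th image of \<open>I\<close>, \<open>G j\<close> its interior, and \<open>len j\<close> its length.\<close>
  define Q where "Q j = (f ^^ j) q" for j
  define W where "W j = (f ^^ j) ?t" for j
  define len where "len j = \<bar>W j - Q j\<bar>" for j
  have qcl: "q \<in> {q..?t}" "?t \<in> {q..?t}" using qt by auto
  have WQ: "W j \<noteq> Q j" for j using inj_onD[OF inj[of j] _ qcl(2,1)] qt by (auto simp: W_def Q_def)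
  then have len0: "0 < len j" for j by (simp add: len_def)
  have mem: "Q j \<in> {a..b}" "W j \<in> {a..b}" for j using iter_mem q_mem t_mem by (auto simp: Q_def W_def)
  define G where "G j = {min (Q j) (W j)<..<max (Q j) (W j)}" for j
  have G_I: "u \<in> (f ^^ j) ` I" if "u \<in> G j" for u j
  proof -
    have "connected ((f ^^ j) ` {q..?t})" using connected_iter cl_sub by simp
    moreover have "min (Q j) (W j) \<in> (f ^^ j) ` {q..?t}" "max (Q j) (W j) \<in> (f ^^ j) ` {q..?t}"
      using qcl unfolding Q_def W_def min_def max_def by auto
    ultimately have "u \<in> (f ^^ j) ` {q..?t}"
      by (rule connectedD_interval) (use that in \<open>auto simp: G_def\<close>)
    then obtain s where s: "s \<in> {q..?t}" "u = (f ^^ j) s" by blast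
    have "s \<noteq> q" using s that by (auto simp: G_def Q_def min_def max_def split: if_splits)
    then show ?thesis using s by (auto simp: I_def)
  qed
  have G_disj: "disjoint_family G"
    unfolding disjoint_family_on_def using G_I I_disj by (metis (no_types, lifting) disjoint_iff imageE)
  have G_measure: "measure lborel (G j) = len j" for j by (auto simp: G_def len_def min_def max_def)
  have sum_le: "(\<Sum>j<n. len j) \<le> b - a" for n
  proof -
    have "(\<Sum>j<n. len j) = (\<Sum>j<n. measure lborel (G j))" by (simp add: G_measure)
    also have "\<dots> = measure lborel (\<Union>j<n. G j)"
    proof (rule measure_finite_Union[symmetric])
      show "disjoint_family_on G {..<n}" using G_disj by (rule disjoint_family_on_mono[rotated]) simp
    qed (auto simp: G_def)
    also have "\<dots> \<le> measure lborel {a..b}"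
    proof (rule measure_mono_fmeasurable)
      have "G j \<subseteq> {a..b}" for j using mem[of j] by (auto simp: G_def)
      show "{a..b} \<in> fmeasurable lborel" using ac cb by (intro fmeasurableI) auto
      from \<open>\<And>j. G j \<subseteq> {a..b}\<close> show "(\<Union>j<n. G j) \<subseteq> {a..b}" by blast
    qed (auto simp: G_def)
    also have "\<dots> = b - a" using ac cb by simp
    finally show ?thesis .
  qed
  have "summable len" using len0 sum_le by (intro summableI_nonneg_bounded[of _ "b - a"]) (auto intro: less_imp_le)
  then have "len \<longlonglongrightarrow> 0" by (rule summable_LIMSEQ_zero)
  then have len_small: "\<exists>n0. \<forall>n\<ge>n0. len n < \<epsilon>" if "\<epsilon> > 0" for \<epsilon>
    using that len0 unfolding LIMSEQ_def dist_real_def by (metis abs_of_pos diff_zero)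
  obtain m0 where m0: "m0 > 0" "\<And>z. z \<in> {a..b} \<Longrightarrow> \<rho> \<le> \<bar>z - c\<bar> \<Longrightarrow> m0 \<le> \<bar>f' z\<bar>"
    using deriv_bounded_below[OF \<rho>(1)] by blast
  \<comment> \<open>A step from time \<open>j\<close> to time \<open>j + 1\<close> worsens the ratio by at most \<open>exp (\<Lambda> * len j)\<close>, because two points
    at distance at most \<open>2 * len j\<close> have derivatives that differ by at most \<open>2 * L * len j\<close>.\<close>
  define \<Lambda> where "\<Lambda> = 2 * L / m0"
  have \<Lambda>0: "0 \<le> \<Lambda>" using L_nonneg m0 by (simp add: \<Lambda>_def)
  have qa: "a < q"
    using below[OF qcl(1), of 0] below[OF qcl(2), of 0] WQ[of 1] mem[of 1] by (force simp: Q_def W_def)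
  define \<theta> where "\<theta> = min ((?t - q) / exp (\<Lambda> * (b - a))) (q - a)"
  have \<theta>0: "\<theta> > 0" using qa qt by (simp add: \<theta>_def)
  define E where "E j = exp (\<Lambda> * (\<Sum>i<j. len i))" for j
  have E_le: "E j \<le> exp (\<Lambda> * (b - a))" for j
    unfolding E_def using sum_le[of j] \<Lambda>0 by (simp add: mult_left_mono)
  \<comment> \<open>The second bound follows from the first by the choice of \<open>\<theta>\<close>, and is used at the next time.\<close>
  have distortion: "\<bar>(f ^^ j) z - Q j\<bar> * (?t - q) \<le> \<bar>z - q\<bar> * E j * len j
      \<and> \<bar>(f ^^ j) z - Q j\<bar> \<le> len j" if z: "z \<in> {q - \<theta>..q}" for z j
  proof -
    have zab: "z \<in> {a..b}" using z q_mem by (auto simp: \<theta>_def)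
    have second: "\<bar>(f ^^ j) z - Q j\<bar> \<le> len j"
      if "\<bar>(f ^^ j) z - Q j\<bar> * (?t - q) \<le> \<bar>z - q\<bar> * E j * len j" for j
    proof -
      have "\<bar>z - q\<bar> \<le> (?t - q) / exp (\<Lambda> * (b - a))" using z by (auto simp: \<theta>_def)
      then have "\<bar>z - q\<bar> * exp (\<Lambda> * (b - a)) \<le> ?t - q" by (simp add: pos_le_divide_eq)
      moreover have "\<bar>z - q\<bar> * E j \<le> \<bar>z - q\<bar> * exp (\<Lambda> * (b - a))"
        using E_le by (intro mult_left_mono) auto
      ultimately have "\<bar>z - q\<bar> * E j * len j \<le> (?t - q) * len j"
        using len0[of j] by (intro mult_right_mono) auto
      then have "\<bar>(f ^^ j) z - Q j\<bar> * (?t - q) \<le> len j * (?t - q)" using that by (simp add: mult.commute)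
      then show ?thesis using qt by simp
    qed
    have first: "\<bar>(f ^^ j) z - Q j\<bar> * (?t - q) \<le> \<bar>z - q\<bar> * E j * len j" for j
    proof (induction j)
      case 0
      show ?case using qt by (simp add: Q_def W_def len_def E_def)
    next
      case (Suc j)
      let ?e = "(f ^^ j) z"
      have eab: "?e \<in> {a..b}" using iter_mem zab by blast
      have elen: "\<bar>?e - Q j\<bar> \<le> len j" using second Suc by blast
      have Qs: "Q (Suc j) = f (Q j)" "W (Suc j) = f (W j)" by (simp_all add: Q_def W_def)
      obtain \<zeta> where \<zeta>: "\<zeta> \<in> G j" "len (Suc j) = \<bar>f' \<zeta>\<bar> * len j"
        using mvt_f[OF mem(1)[of j] mem(2)[of j]] WQ[of j] by (auto simp: G_def len_def Qs)
      obtain s where s: "s \<in> I" "\<zeta> = (f ^^ j) s" using G_I[OF \<zeta>(1)] by blast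
      have \<zeta>ab: "\<zeta> \<in> {a..b}" using s I_sub iter_mem by blast
      have f\<zeta>: "m0 \<le> \<bar>f' \<zeta>\<bar>" using m0(2)[OF \<zeta>ab] far[of s j] s by (auto simp: I_def)
      have ES: "E (Suc j) = E j * exp (\<Lambda> * len j)" by (simp add: E_def distrib_left exp_add)
      have E0: "0 < E j" for j by (simp add: E_def)
      show ?case
      proof (cases "?e = Q j")
        case True
        then have "(f ^^ Suc j) z = Q (Suc j)" by (simp add: Qs)
        moreover have "0 \<le> \<bar>z - q\<bar> * E (Suc j) * len (Suc j)"
          using E0[of "Suc j"] len0[of "Suc j"] by (intro mult_nonneg_nonneg) auto
        ultimately show ?thesis by simp
      next
        case False
        then obtain \<xi> where \<xi>: "min (Q j) ?e < \<xi>" "\<xi> < max (Q j) ?e" "\<bar>f ?e - f (Q j)\<bar> = \<bar>f' \<xi>\<bar> * \<bar>?e - Q j\<bar>"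
          using mvt_f[OF mem(1)[of j] eab] by metis
        have \<xi>ab: "\<xi> \<in> {a..b}" using \<xi>(1,2) mem(1)[of j] eab by (auto simp: min_def max_def split: if_splits)
        have "\<bar>\<xi> - Q j\<bar> \<le> len j" using \<xi>(1,2) elen by (auto simp: min_def max_def abs_if split: if_splits)
        moreover have "\<bar>\<zeta> - Q j\<bar> \<le> len j" using \<zeta>(1) by (auto simp: G_def len_def min_def max_def abs_if split: if_splits)
        ultimately have "\<bar>\<xi> - \<zeta>\<bar> \<le> 2 * len j" by linarith
        then have "L * \<bar>\<xi> - \<zeta>\<bar> \<le> L * (2 * len j)" using L_nonneg by (intro mult_left_mono) auto
        also have "\<dots> = m0 * (\<Lambda> * len j)" using m0(1) by (simp add: \<Lambda>_def)
        also have "\<dots> \<le> \<bar>f' \<zeta>\<bar> * (\<Lambda> * len j)" using f\<zeta> \<Lambda>0 len0[of j] by (intro mult_right_mono) auto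
        finally have "\<bar>f' \<xi>\<bar> \<le> \<bar>f' \<zeta>\<bar> * (1 + \<Lambda> * len j)"
          using lipschitz[OF \<xi>ab \<zeta>ab] by (simp add: distrib_left)
        also have "\<dots> \<le> \<bar>f' \<zeta>\<bar> * exp (\<Lambda> * len j)" by (intro mult_left_mono exp_ge_add_one_self) auto
        finally have f\<xi>: "\<bar>f' \<xi>\<bar> \<le> \<bar>f' \<zeta>\<bar> * exp (\<Lambda> * len j)" .
        have "\<bar>(f ^^ Suc j) z - Q (Suc j)\<bar> * (?t - q) = \<bar>f' \<xi>\<bar> * (\<bar>?e - Q j\<bar> * (?t - q))"
          using \<xi>(3) by (simp add: Qs)
        also have "\<dots> \<le> (\<bar>f' \<zeta>\<bar> * exp (\<Lambda> * len j)) * (\<bar>z - q\<bar> * E j * len j)"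
          by (rule mult_mono[OF f\<xi> Suc]) (use qt in auto)
        also have "\<dots> = \<bar>z - q\<bar> * E (Suc j) * len (Suc j)" by (simp add: ES \<zeta>(2))
        finally show ?thesis .
      qed
    qed
    show ?thesis using first second by blast
  qed
  obtain n1 where n1: "\<And>n. n \<ge> n1 \<Longrightarrow> q - \<theta> / 2 < m n" using q_approx[of "\<theta> / 2"] \<theta>0 by auto
  obtain n2 where n2: "\<And>n. n \<ge> n2 \<Longrightarrow> len n < min (\<theta> / 4) (?t - q)"
    using len_small[of "min (\<theta> / 4) (?t - q)"] \<theta>0 qt by auto
  define n where "n = max n1 n2"
  define p where "p = P n"
  have p1: "p \<ge> 1" using P1 by (simp add: p_def)
  have mn: "q - \<theta> / 2 < m n" using n1 by (simp add: n_def)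
  have lenp: "len p < \<theta> / 4" "len p < ?t - q" using n2[of p] Pge[of n] by (auto simp: p_def n_def)
  have I_lower: "m k \<le> (f ^^ P k) s" if "s \<in> I" for s k
  proof -
    obtain u where u: "u \<in> C k" "s = f u" using I_C[OF \<open>s \<in> I\<close>, of k] by blast
    have "(f ^^ P k) u \<in> C k" using periodic_intervalD(6)[OF C(1)] u by blast
    then have "m k \<le> f ((f ^^ P k) u)" by (rule m_le)
    then show ?thesis using u by (simp add: funpow_swap1)
  qed
  have tI: "?t \<in> I" using qt by (simp add: I_def)
  have I_upper: "(f ^^ j) s \<le> q" if "j \<ge> 1" "s \<in> {q..?t}" for s j
    using below[OF that(2), of "j - 1"] that(1) by simp
  have "\<exists>z\<in>{q - \<theta>..?t}. (f ^^ p) z = z"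
  proof (rule brouwer)
    show "continuous_on {q - \<theta>..?t} (f ^^ p)"
      by (rule continuous_on_subset[OF cont_iter]) (use t_mem in \<open>auto simp: \<theta>_def\<close>)
    show "(f ^^ p) \<in> {q - \<theta>..?t} \<rightarrow> {q - \<theta>..?t}"
    proof
      fix z assume z: "z \<in> {q - \<theta>..?t}"
      show "(f ^^ p) z \<in> {q - \<theta>..?t}"
      proof (cases "z \<in> I")
        case True
        then show ?thesis using I_lower[OF True, of n] I_upper[OF p1, of z] mn \<theta>0 qt by (auto simp: p_def I_def)
      next
        case False
        then have "\<bar>(f ^^ p) z - Q p\<bar> \<le> len p" using distortion[of z p] z by (auto simp: I_def)
        moreover have "Q p \<le> q" using I_upper[OF p1 qcl(1)] by (simp add: Q_def)
        moreover have "\<bar>W p - Q p\<bar> = len p" by (simp add: len_def)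
        moreover have "m n \<le> W p" using I_lower[OF tI, of n] by (simp add: W_def p_def)
        ultimately show ?thesis using lenp mn by (auto simp: abs_le_iff)
      qed
    qed
  qed (use qt \<theta>0 in auto)
  then obtain z where z: "z \<in> {q - \<theta>..?t}" "(f ^^ p) z = z" by blast
  have "z \<notin> I" using I_disj[of z z p 0] z p1 by auto
  then have zq: "z \<in> {q - \<theta>..q}" using z by (auto simp: I_def)
  have fix_mult: "(f ^^ (p * k)) u = u" if "(f ^^ p) u = u" for k u
    using that by (induction k) (auto simp: iter_add)
  have "z = q"
  proof (rule ccontr)
    assume "z \<noteq> q"
    then have e0: "0 < \<bar>z - q\<bar>" by simp
    obtain k1 where k1: "\<And>k. k \<ge> k1 \<Longrightarrow> q - \<bar>z - q\<bar> / 2 < m k" using q_approx[of "\<bar>z - q\<bar> / 2"] e0 by auto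
    obtain k2 where k2: "\<And>k. k \<ge> k2 \<Longrightarrow> len k < \<bar>z - q\<bar> / 4" using len_small[of "\<bar>z - q\<bar> / 4"] e0 by auto
    define k where "k = max n (max k1 k2)"
    obtain l where l: "P k = p * l" using Pdvd[of n k] by (auto simp: p_def k_def)
    have "(f ^^ P k) z = z" using fix_mult[OF z(2)] l by simp
    then have "\<bar>z - Q (P k)\<bar> \<le> len (P k)" using distortion[OF zq, of "P k"] by simp
    moreover have "\<bar>W (P k) - Q (P k)\<bar> = len (P k)" by (simp add: len_def)
    moreover have "m k \<le> W (P k)" "W (P k) \<le> q"
      using I_lower[OF tI, of k] I_upper[OF P1 qcl(2), of k] by (simp_all add: W_def)
    moreover have "len (P k) < \<bar>z - q\<bar> / 4" using k2[of "P k"] Pge[of k] by (simp add: k_def)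
    moreover have "q - \<bar>z - q\<bar> / 2 < m k" using k1 by (simp add: k_def)
    moreover have "\<bar>z - q\<bar> \<le> \<bar>z - Q (P k)\<bar> + \<bar>W (P k) - Q (P k)\<bar> + \<bar>W (P k) - q\<bar>" by linarith
    ultimately show False by (simp add: field_simps)
  qed
  then have fq: "Q p = q" "Q (2 * p) = q" using z(2) fix_mult[of q 2] by (auto simp: Q_def mult.commute)
  have Wlt: "W p < q" "W (2 * p) < q"
    using I_upper[OF _ qcl(2), of p] I_upper[OF _ qcl(2), of "2 * p"] p1 WQ[of p] WQ[of "2 * p"] fq
    by (auto simp: W_def less_le)
  define u where "u = (max (W p) (W (2 * p)) + q) / 2"
  have "u \<in> G p" "u \<in> G (2 * p)" using Wlt fq by (auto simp: G_def u_def min_def max_def)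
  then obtain s s' where "s \<in> I" "s' \<in> I" "(f ^^ p) s = (f ^^ (2 * p)) s'" using G_I by blast
  then have "p = 2 * p" by (rule I_disj)
  then show False using p1 by simp
qed

end

section \<open>Unbounded periods\<close>

context unimodal
begin

lemma reflect_iter: "((\<lambda>x. - f (- x)) ^^ k) x = - (f ^^ k) (- x)"
  by (induction k) auto

lemma periodic_interval_reflect:
  assumes "periodic_interval K p"
  shows "unimodal.periodic_interval (- b) (- a) (\<lambda>x. - f (- x)) (uminus ` K) p"
  unfolding unimodal.periodic_interval_def[OF reflect]
proof (intro conjI allI impI)
  note KD = periodic_intervalD[OF assms]
  show "uminus ` K \<subseteq> {- b..- a}" "uminus ` K \<noteq> {}" "1 \<le> p" using KD by auto
  show "connected (uminus ` K)" using KD(3) by (intro connected_continuous_image continuous_intros)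
  show "((\<lambda>x. - f (- x)) ^^ p) ` uminus ` K \<subseteq> uminus ` K"
    using KD(6) by (auto simp: reflect_iter)
  fix i j
  assume "((\<lambda>x. - f (- x)) ^^ i) ` uminus ` K \<inter> ((\<lambda>x. - f (- x)) ^^ j) ` uminus ` K \<noteq> {}"
  then obtain u v where "u \<in> K" "v \<in> K" "(f ^^ i) u = (f ^^ j) v" by (auto simp: reflect_iter)
  then show "i mod p = j mod p" by (rule periodic_interval_disjoint[OF assms])
qed

lemma no_wandering_turning_interval:
  assumes C: "\<And>n. periodic_interval (C n) (P n)" "\<And>n. c \<in> C n" "\<And>n::nat. C (Suc n) \<subseteq> C n"
    and P: "strict_mono P" "\<And>n. P n dvd P (Suc n)"
    and d: "d \<noteq> c" "\<And>n. d \<in> C n"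
  shows False
proof (cases "\<forall>x\<in>{a..b}. f x \<le> f c")
  case True
  then show ?thesis using no_wandering_turning_interval_max[OF _ C P d] by blast
next
  case False
  then have min: "\<forall>x\<in>{a..b}. f c \<le> f x" using turning by blast
  show False
  proof (rule unimodal.no_wandering_turning_interval_max[OF reflect _ periodic_interval_reflect[OF C(1)] _ _ P])
    have "- x \<in> {a..b}" if "x \<in> {- b..- a}" for x using that by auto
    then show "\<forall>x\<in>{- b..- a}. - f (- x) \<le> - f (- (- c))" using min by auto
    show "uminus ` C (Suc n) \<subseteq> uminus ` C n" for n using C(3) by (rule image_mono)
    show "- d \<noteq> - c" using d by simp
  qed (use C(2) d in auto)
qed

end

context left_limit
begin

text \<open>The periods take arbitrarily large values at arbitrarily small widths.\<close>

lemma per_large: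
  assumes "ok e1"
  shows "\<exists>e. 0 < e \<and> e \<le> e1 \<and> B < per e"
proof (induction B)
  case 0
  then show ?case using per_prop(1)[OF assms] assms by (intro exI[of _ e1]) (auto simp: ok_def)
next
  case (Suc B)
  then obtain e where e: "0 < e" "e \<le> e1" "B < per e" by blast
  have oke: "ok e" using ok_le assms e by blast
  obtain e' where e': "0 < e'" "e' \<le> e" "per e' \<noteq> per e" using period_unbounded[OF oke] by blast
  have "ok e'" using ok_le oke e' by blast
  then have "per e \<le> per e'" using per_mono_dvd[OF oke e'(1,2)] per_prop(1)[of e'] by (intro dvd_imp_le) auto
  then show ?case using e e' by (intro exI[of _ e']) auto
qed

text \<open>The infinitely renormalizable case. The steps \<open>right\<close> and \<open>piece\<close> say that \<open>K e\<close> lies to the left of its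
other images inside \<open>K e1\<close>.\<close>

lemma contradiction: False
proof -
  obtain s where s: "backward_orbit {a..b} f x s" "\<And>n. good (s n)" using good_orbit by blast
  obtain \<eta> N where \<eta>: "\<eta> > 0" "\<And>n. n \<ge> N \<Longrightarrow> \<eta> \<le> \<bar>s n - y\<bar>"
    using no_cluster[OF s(1)] unfolding clusters_at_def by (meson not_le)
  obtain e1 where e1: "ok e1" "\<And>e u. 0 < e \<Longrightarrow> e \<le> e1 \<Longrightarrow> u \<in> K e \<Longrightarrow> y - \<eta> < u"
    using K_left_end[OF \<eta>(1)] by metis
  have e1_pos: "0 < e1" using e1 by (simp add: ok_def)
  have oke: "ok e" if "0 < e" "e \<le> e1" for e using ok_le e1(1) that by blast
  have far: "y + \<eta> \<le> s n" if "n \<ge> N" "s n \<in> K e1" for n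
    using e1(2)[OF e1_pos order_refl that(2)] \<eta>(2)[OF that(1)] by (auto simp: abs_if split: if_splits)
  have right: "v < u" if e: "0 < e" "e \<le> e1" and j: "0 < j" "j < per e"
    and sub: "(f ^^ j) ` K e \<subseteq> K e1" and u: "u \<in> (f ^^ j) ` K e" and v: "v \<in> K e" for e j u v
  proof (rule ccontr)
    assume "\<not> v < u"
    obtain n where n: "n \<ge> N" "s n \<in> (f ^^ j) ` K e"
      using good_orbit_visits[OF s oke[OF e] j(2)] by blast
    have big: "y < s n" using far[OF n(1)] n(2) sub \<eta>(1) by force
    have disj: "w \<notin> (f ^^ j) ` K e" if "w \<in> K e" for w
    proof
      assume "w \<in> (f ^^ j) ` K e"
      then obtain w' where "w' \<in> K e" "(f ^^ j) w' = (f ^^ 0) w" by auto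
      then have "j mod per e = 0 mod per e"
        using periodic_interval_disjoint[OF K_periodic[OF oke[OF e]] _ that, of w' j 0] by blast
      then show False using j by simp
    qed
    show False
    proof (cases "v < s n")
      case True
      have "connected ((f ^^ j) ` K e)" using connected_iter K_conn K_sub[OF oke[OF e]] by blast
      then have "v \<in> (f ^^ j) ` K e" using connectedD_interval[OF _ u n(2), of v] True \<open>\<not> v < u\<close> by simp
      then show False using disj v by blast
    next
      case False
      have "y - e / 2 \<le> s n" using big e by simp
      then have "s n \<in> K e" using connectedD_interval[OF K_conn mid_K[OF oke[OF e]] v, of "s n"] False by simp
      then show False using disj n by blast
    qed
  qed
  let ?p = "per e1" let ?g = "f ^^ per e1"
  note K1 = K_periodic[OF e1(1)]
  obtain d i where d: "d \<in> K e1" "i < ?p" "(f ^^ i) d = c" using turning_point_exists[OF e1(1)] by blast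
  have p0: "?p > 0" using d by simp
  have piece: "v < u"
    if e: "0 < e" "e \<le> e1" and k: "\<not> per e dvd k * ?p" and u: "u \<in> (f ^^ (k * ?p)) ` K e" and v: "v \<in> K e" for e k u v
  proof -
    define j where "j = (k * ?p) mod per e"
    have pe: "per e > 0" using per_prop(1)[OF oke[OF e]] by simp
    have "0 < j" "j < per e" using k pe by (auto simp: j_def mod_greater_zero_iff_not_dvd)
    moreover have "?p dvd j" using per_mono_dvd[OF e1(1) e] by (simp add: j_def dvd_mod)
    then have "(f ^^ j) ` K e \<subseteq> K e1"
      using periodic_interval_dvd[OF K1, of j] K_mono[OF e1(1) e] by auto
    moreover have "(f ^^ (k * ?p)) ` K e \<subseteq> (f ^^ j) ` K e"
      by (rule periodic_interval_mod[OF K_periodic[OF oke[OF e]]]) (auto simp: j_def)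
    ultimately show ?thesis using right[OF e, of j u v] u v by blast
  qed
  have piece_dvd: "u \<in> K e" if "0 < e" "e \<le> e1" "per e dvd k * ?p" "u \<in> (f ^^ (k * ?p)) ` K e" for e k u
    using periodic_interval_dvd[OF K_periodic[OF oke[OF that(1,2)]] that(3)] that(4) by blast
  have step: "(f ^^ l) u \<in> (f ^^ ((k + 1) * ?p)) ` K e" if "u \<in> (f ^^ (k * ?p)) ` K e" "l = ?p" for e k l u
  proof -
    obtain v where "v \<in> K e" "u = (f ^^ (k * ?p)) v" using \<open>u \<in> _\<close> by blast
    then have "(f ^^ l) u = (f ^^ ((k + 1) * ?p)) v" using that(2) by (simp add: distrib_right iter_add add.commute)
    then show ?thesis using \<open>v \<in> K e\<close> by blast
  qed
  \<comment> \<open>With \<open>g = f ^^ per e1\<close> and turning point \<open>d\<close>, the leftmost image \<open>K e\<close> contains \<open>g d\<close> if \<open>g d\<close> is the minimum of \<open>g\<close>,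
    and \<open>g (g d)\<close> if \<open>g d\<close> is the maximum; both are iterates of \<open>c\<close> at times that do not depend on \<open>e\<close>.\<close>
  have crit_orbit: "\<exists>S\<ge>1. \<forall>e. 0 < e \<and> e \<le> e1 \<longrightarrow> (f ^^ S) c \<in> K e"
  proof -
    consider (max) "\<forall>z\<in>K e1. ?g z \<le> ?g d" "strict_mono_on (K e1 \<inter> {..d}) ?g" "strict_antimono_on (K e1 \<inter> {d..}) ?g"
      | (min) "\<forall>z\<in>K e1. ?g d \<le> ?g z"
      using iter_turning_point[OF K1 d(2,1,3)] by blast
    then show ?thesis
    proof cases
      case min
      have "?g d \<in> K e" if e: "0 < e" "e \<le> e1" for e
      proof (rule ccontr)
        assume nin: "?g d \<notin> K e"
        obtain u where "d \<in> (f ^^ (u * ?p)) ` K e" using turning_point[OF e1(1) e d] by blast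
        then have gd: "?g d \<in> (f ^^ ((u + 1) * ?p)) ` K e" by (rule step) simp
        define v' where "v' = y - e / 2"
        have v': "v' \<in> K e" using mid_K[OF oke[OF e]] by (simp add: v'_def)
        have v: "(f ^^ per e) v' \<in> K e" using per_prop(2)[OF oke[OF e]] v' by blast
        have "\<not> per e dvd (u + 1) * ?p" using nin piece_dvd[OF e _ gd] by blast
        then have lt: "(f ^^ per e) v' < ?g d" using piece[OF e _ gd v] by blast
        obtain r where r: "per e = ?p * r" using per_mono_dvd[OF e1(1) e] by blast
        then obtain r' where "r = Suc r'" using per_prop(1)[OF oke[OF e]] by (cases r) auto
        then have "per e = ?p + ?p * r'" using r by simp
        then have "(f ^^ per e) v' = ?g ((f ^^ (?p * r')) v')" by (metis iter_add)
        moreover have "(f ^^ (?p * r')) v' \<in> K e1"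
          using periodic_interval_dvd[OF K1, of "?p * r'" v'] K_mono[OF e1(1) e] v' by auto
        ultimately have "?g d \<le> (f ^^ per e) v'" using min by metis
        then show False using lt by simp
      qed
      moreover have "(f ^^ (?p - i)) c = ?g d" using iter_add[of "?p - i" i d] d by simp
      ultimately show ?thesis using d by (intro exI[of _ "?p - i"]) auto
    next
      case max
      have "?g (?g d) \<in> K e" if e: "0 < e" "e \<le> e1" for e
      proof (rule ccontr)
        assume nin: "?g (?g d) \<notin> K e"
        have sub: "K e \<subseteq> K e1" using K_mono[OF e1(1) e] .
        obtain u where "d \<in> (f ^^ (u * ?p)) ` K e" using turning_point[OF e1(1) e d] by blast
        then have "?g d \<in> (f ^^ ((u + 1) * ?p)) ` K e" by (rule step) simp
        then have ggd: "?g (?g d) \<in> (f ^^ ((u + 1 + 1) * ?p)) ` K e" by (rule step) simp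
        have nd: "\<not> per e dvd (u + 1 + 1) * ?p" using nin piece_dvd[OF e _ ggd] by blast
        define v' where "v' = y - e / 2"
        have v': "v' \<in> K e" using mid_K[OF oke[OF e]] by (simp add: v'_def)
        define v where "v = (f ^^ per e) v'"
        have v: "v \<in> K e" using per_prop(2)[OF oke[OF e]] v' by (auto simp: v_def)
        have lt: "v < ?g (?g d)" using piece[OF e nd ggd v] .
        obtain r where r: "per e = ?p * r" using per_mono_dvd[OF e1(1) e] by blast
        have "r \<noteq> 0" using r per_prop(1)[OF oke[OF e]] by auto
        moreover have "r \<noteq> 1" using nd r by auto
        ultimately obtain r' where r': "r = Suc (Suc r')" by (metis One_nat_def not0_implies_Suc)
        \<comment> \<open>\<open>v \<in> K e\<close> is the image of \<open>z\<close>, and \<open>z\<close> the image of \<open>w\<close>; here \<open>K e\<close> has at least two images in \<open>K e1\<close>.\<close>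
        define w where "w = (f ^^ (?p * r')) v'"
        define z where "z = ?g w"
        have wK: "w \<in> K e1" unfolding w_def
          using periodic_interval_dvd[OF K1, of "?p * r'" v'] sub v' by auto
        have zK: "z \<in> K e1" using periodic_interval_dvd[OF K1 _ wK] by (simp add: z_def)
        have z_eq: "z = (f ^^ (Suc r' * ?p)) v'" by (simp add: z_def w_def mult.commute iter_add)
        have gz: "?g z = v"
        proof -
          have "per e = ?p + Suc r' * ?p" using r r' by (simp add: mult.commute)
          then show ?thesis unfolding v_def z_eq by (metis iter_add)
        qed
        have ndr: "\<not> per e dvd k * ?p" if "0 < k" "k < r" for k
          using that p0 r by (auto simp: mult.commute dest!: dvd_imp_le)
        have vz: "v < z"
          using piece[OF e ndr[of "Suc r'"] _ v, of z] r' z_eq v' by auto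
        have zgd: "z \<le> ?g d" using max(1) wK by (simp add: z_def)
        show False
        proof (cases "z < d")
          case True
          then have "?g v < ?g z" using monotone_onD[OF max(2), of v z] vz zK v sub by auto
          moreover have "v < ?g v"
          proof (rule piece[OF e ndr[of 1] _ v])
            show "?g v \<in> (f ^^ (1 * ?p)) ` K e" using v by simp
          qed (use r' in auto)
          ultimately show False using gz by simp
        next
          case False
          have "?g d \<in> K e1" using periodic_interval_dvd[OF K1 _ d(1)] by simp
          then have "z \<in> K e1 \<inter> {d..}" "?g d \<in> K e1 \<inter> {d..}" using False zK zgd by auto
          then have "z = ?g d \<or> ?g (?g d) < ?g z"
            using monotone_onD[OF max(3), of z "?g d"] zgd by (cases "z = ?g d") simp_all
          then show False using lt gz by auto
        qed
      qed
      moreover have "(f ^^ (?p + (?p - i))) c = ?g (?g d)"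
      proof -
        have "(f ^^ (?p - i)) c = ?g d" using iter_add[of "?p - i" i d] d by simp
        then show ?thesis by (simp only: iter_add)
      qed
      ultimately show ?thesis using d by (intro exI[of _ "?p + (?p - i)"]) auto
    qed
  qed
  then obtain S where S: "S \<ge> 1" "\<And>e. 0 < e \<Longrightarrow> e \<le> e1 \<Longrightarrow> (f ^^ S) c \<in> K e" by blast
  \<comment> \<open>If \<open>S < per e\<close>, then \<open>C e\<close> is the image of \<open>K e\<close> that contains \<open>c\<close>, and \<open>f ^^ S\<close> maps it onto the \<open>per e\<close>-th image of \<open>K e\<close>.\<close>
  define C where "C e = (f ^^ (per e - S)) ` K e" for e
  have C_per: "periodic_interval (C e) (per e)" if "0 < e" "e \<le> e1" for e
    unfolding C_def using periodic_interval_image[OF K_periodic[OF oke[OF that]]] .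
  have C_c: "c \<in> C e" if e: "0 < e" "e \<le> e1" "S < per e" for e
  proof -
    obtain j v where j: "j < per e" "v \<in> K e" "c = (f ^^ j) v"
      using M_pieces[OF oke[OF e(1,2)] c_in_M[OF oke[OF e(1,2)]]] by blast
    have "(f ^^ (S + j)) v \<in> K e" using S(2)[OF e(1,2)] j(3) by (simp add: iter_add)
    then have "per e dvd S + j" using periodic_interval_return[OF K_periodic[OF oke[OF e(1,2)]] j(2)] by blast
    then obtain l where l: "S + j = per e * l" by blast
    have "l \<noteq> 0" using l S(1) by (cases l) auto
    moreover have "l < 2"
    proof (rule ccontr)
      assume "\<not> l < 2"
      then have "per e * 2 \<le> per e * l" by simp
      then show False using l j(1) e(3) by linarith
    qed
    ultimately have "l = 1" by simp
    then have "j = per e - S" using l by simp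
    then show ?thesis using j by (auto simp: C_def)
  qed
  have C_mono: "C e' \<subseteq> C e" if e: "0 < e'" "e' \<le> e" "e \<le> e1" "S < per e" for e e'
  proof -
    have e': "0 < e" "e' \<le> e1" using e by auto
    have dv: "per e dvd per e'" using per_mono_dvd[OF oke[OF e'(1) e(3)] e(1,2)] .
    have le: "per e \<le> per e'" using dv per_prop(1)[OF oke[OF e(1) e'(2)]] by (intro dvd_imp_le) auto
    have "per e dvd (per e' - S) - (per e - S)" using dv le e(4) by simp
    then have "(per e' - S) mod per e = (per e - S) mod per e"
      using le by (metis diff_le_mono mod_eq_dvd_iff_nat)
    then have "(f ^^ (per e' - S)) ` K e \<subseteq> (f ^^ (per e - S)) ` K e"
      using le by (intro periodic_interval_mod[OF K_periodic[OF oke[OF e'(1) e(3)]]]) auto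
    then show ?thesis unfolding C_def using K_mono[OF oke[OF e'(1) e(3)] e(1,2)] by blast
  qed
  \<comment> \<open>The \<open>per e\<close>-th image of \<open>K e\<close> reaches up to \<open>y + \<eta>\<close> because of the good orbit, and to the left of \<open>y\<close> because
    backward orbits return to \<open>U e\<close>.\<close>
  have C_wide: "\<exists>u\<in>C e. \<exists>v\<in>C e. \<eta> \<le> \<bar>(f ^^ S) u - (f ^^ S) v\<bar>" if e: "0 < e" "e \<le> e1" "S < per e" for e
  proof -
    note Ke = K_periodic[OF oke[OF e(1,2)]]
    have *: "\<exists>u\<in>C e. (f ^^ S) u = (f ^^ per e) w" if "w \<in> K e" for w
    proof -
      have "(f ^^ S) ((f ^^ (per e - S)) w) = (f ^^ per e) w" using e(3) by (simp flip: iter_add)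
      then show ?thesis using that by (auto simp: C_def)
    qed
    have "0 < per e" using e by simp
    then obtain n where n: "n \<ge> N + per e" "s n \<in> (f ^^ 0) ` K e"
      using good_orbit_visits[OF s oke[OF e(1,2)]] by blast
    have snK: "s n \<in> K e" using n by simp
    have sn: "(f ^^ per e) (s n) = s (n - per e)"
      using backward_orbit_iter_le[OF s(1), of "n - per e" n] n by simp
    have "s (n - per e) \<in> K e" using per_prop(2)[OF oke[OF e(1,2)]] snK sn by (metis image_subset_iff)
    then have hi: "y + \<eta> \<le> s (n - per e)" using far[of "n - per e"] K_mono[OF e1(1) e(1,2)] n by auto
    obtain z s' where s': "backward_orbit {a..b} f x s'" "\<And>N. \<exists>n\<ge>N. s' n \<in> U e"
      using accum_U[OF oke[OF e(1,2)]] by metis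
    then obtain k l where kl: "s' k \<in> U e" "l \<ge> Suc k" "s' l \<in> U e" by meson
    have slK: "s' l \<in> K e" "s' k \<in> K e" using U_K[OF oke[OF e(1,2)]] kl by auto
    have it: "(f ^^ (l - k)) (s' l) = s' k" using backward_orbit_iter_le[OF s'(1), of k l] kl by simp
    then have "per e dvd l - k" using periodic_interval_return[OF Ke slK(1)] slK by simp
    then obtain r where r: "l - k = per e * r" by blast
    then obtain r' where "r = Suc r'" using kl by (cases r) auto
    then have "l - k = per e + per e * r'" using r by simp
    then have lo_eq: "(f ^^ per e) ((f ^^ (per e * r')) (s' l)) = s' k" using it by (metis iter_add)
    have loK: "(f ^^ (per e * r')) (s' l) \<in> K e" using periodic_interval_dvd[OF Ke _ slK(1)] by simp
    have lo: "s' k < y" using kl by (simp add: U_def)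
    obtain u v where "u \<in> C e" "(f ^^ S) u = s (n - per e)" "v \<in> C e" "(f ^^ S) v = s' k"
      using *[OF snK] *[OF loK] sn lo_eq by metis
    then show ?thesis using hi lo by (intro bexI[of _ u] bexI[of _ v]) auto
  qed
  have "\<exists>e. \<forall>n::nat. (0 < e n \<and> e n \<le> e1 \<and> S < per (e n)) \<and> (e (Suc n) \<le> e n \<and> per (e n) < per (e (Suc n)))"
  proof (rule dependent_nat_choice)
    show "\<exists>e. 0 < e \<and> e \<le> e1 \<and> S < per e" using per_large[OF e1(1)] .
    fix e and n :: nat assume e: "0 < e \<and> e \<le> e1 \<and> S < per e"
    then obtain e' where "0 < e'" "e' \<le> e" "per e < per e'" using per_large[OF oke, of e "per e"] by blast
    then show "\<exists>e'. (0 < e' \<and> e' \<le> e1 \<and> S < per e') \<and> (e' \<le> e \<and> per e < per e')"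
      using e by (intro exI[of _ e']) auto
  qed
  then obtain e where e: "\<And>n::nat. 0 < e n" "\<And>n. e n \<le> e1" "\<And>n. S < per (e n)"
    "\<And>n. e (Suc n) \<le> e n" "\<And>n. per (e n) < per (e (Suc n))" by metis
  have Cn: "periodic_interval (C (e n)) (per (e n))" "c \<in> C (e n)" "C (e (Suc n)) \<subseteq> C (e n)" for n
    using C_per C_c C_mono e by auto
  obtain d where "d \<noteq> c" "\<And>n. d \<in> C (e n)"
    using nested_common_point[of "\<lambda>n. C (e n)" \<eta> S] periodic_intervalD[OF Cn(1)] Cn \<eta>(1) C_wide e by metis
  moreover have "strict_mono (\<lambda>n. per (e n))" using e by (simp add: strict_mono_Suc_iff)
  moreover have "per (e n) dvd per (e (Suc n))" for n using per_mono_dvd[OF oke] e by blast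
  ultimately show False using no_wandering_turning_interval[of "\<lambda>n. C (e n)" "\<lambda>n. per (e n)" d] Cn by blast
qed

end

section \<open>Special alpha-limit sets are closed\<close>

lemma (in unimodal) clusters_at_left_limit:
  assumes "x \<in> {a..b}" "y \<le> b"
    and "\<And>\<delta>. \<delta> > 0 \<Longrightarrow> \<exists>z s. backward_orbit {a..b} f x s \<and> clusters_at s z \<and> y - \<delta> < z \<and> z < y"
  shows "\<exists>s. backward_orbit {a..b} f x s \<and> clusters_at s y"
proof (rule ccontr)
  assume "\<not> ?thesis"
  then interpret left_limit a b c f f' L x y
    using assms by unfold_locales blast+
  show False by (rule contradiction)
qed

lemma backward_orbit_reflect:
  assumes "backward_orbit {a..b} f x s"
  shows "backward_orbit {- b..- a} (\<lambda>x. - f (- x)) (- x) (\<lambda>n. - s n)"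
  using assms by (auto simp: backward_orbit_def)

lemma clusters_at_reflect:
  assumes "clusters_at s y"
  shows "clusters_at (\<lambda>n. - s n) (- y)"
proof -
  have "\<bar>- s n - - y\<bar> = \<bar>s n - y\<bar>" for n by linarith
  then show ?thesis using assms unfolding clusters_at_def by simp
qed

text \<open>A limit point is approached from the left or from the right, and reflection exchanges the two cases.\<close>

theorem (in unimodal) closed_special_alpha_limit:
  assumes x: "x \<in> {a..b}"
  shows "closed (special_alpha_limit {a..b} f x)"
proof -
  let ?A = "special_alpha_limit {a..b} f x"
  note A_iff = special_alpha_limit_iff[OF maps, of _ x]
  have A_sub: "?A \<subseteq> {a..b}"
  proof
    fix z assume "z \<in> ?A"
    then obtain s where s: "backward_orbit {a..b} f x s" "clusters_at s z" using A_iff by blast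
    have "z \<in> closure {a..b}"
      unfolding closure_approachable dist_real_def
      using s unfolding clusters_at_def backward_orbit_def by blast
    then show "z \<in> {a..b}" by simp
  qed
  have "y \<in> ?A" if lim: "y islimpt ?A" for y
  proof -
    have y: "y \<in> {a..b}" using lim A_sub by (meson closed_limpt closed_atLeastAtMost islimpt_subset)
    have near: "\<exists>z\<in>?A. z \<noteq> y \<and> \<bar>z - y\<bar> < \<delta>" if "\<delta> > 0" for \<delta>
      using lim that unfolding islimpt_approachable dist_real_def by blast
    show ?thesis
    proof (cases "\<forall>\<delta>>0. \<exists>z\<in>?A. y - \<delta> < z \<and> z < y")
      case True
      have "\<exists>s. backward_orbit {a..b} f x s \<and> clusters_at s y"
      proof (rule clusters_at_left_limit[OF x])
        fix \<delta> :: real assume "\<delta> > 0"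
        then show "\<exists>z s. backward_orbit {a..b} f x s \<and> clusters_at s z \<and> y - \<delta> < z \<and> z < y"
          using True A_iff by blast
      qed (use y in simp)
      then show ?thesis using A_iff by blast
    next
      case False
      then obtain \<delta>0 where \<delta>0: "\<delta>0 > 0" "\<And>z. z \<in> ?A \<Longrightarrow> y - \<delta>0 < z \<Longrightarrow> \<not> z < y" by blast
      have "\<exists>s. backward_orbit {- b..- a} (\<lambda>x. - f (- x)) (- x) s \<and> clusters_at s (- y)"
      proof (rule unimodal.clusters_at_left_limit[OF reflect])
        fix \<delta> :: real assume "\<delta> > 0"
        then obtain z where z: "z \<in> ?A" "z \<noteq> y" "\<bar>z - y\<bar> < min \<delta> \<delta>0"
          using near[of "min \<delta> \<delta>0"] \<delta>0(1) by auto
        have "y < z" using \<delta>0(2)[OF z(1)] z(2,3) by (auto simp: abs_less_iff)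
        moreover obtain s where "backward_orbit {a..b} f x s" "clusters_at s z" using A_iff z(1) by blast
        moreover have "z < y + \<delta>" using z(3) by (auto simp: abs_less_iff)
        ultimately show "\<exists>z s. backward_orbit {- b..- a} (\<lambda>x. - f (- x)) (- x) s \<and> clusters_at s z \<and>
            - y - \<delta> < z \<and> z < - y"
          by (intro exI[of _ "- z"] exI[of _ "\<lambda>n. - s n"])
            (auto intro: backward_orbit_reflect clusters_at_reflect)
      qed (use x y in auto)
      then obtain s where "backward_orbit {- b..- a} (\<lambda>x. - f (- x)) (- x) s" "clusters_at s (- y)" by blast
      then have "backward_orbit {a..b} f x (\<lambda>n. - s n)" "clusters_at (\<lambda>n. - s n) y"
        using backward_orbit_reflect[of "- b" "- a" "\<lambda>x. - f (- x)" "- x" s] clusters_at_reflect[of s "- y"]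
        by simp_all
      then show ?thesis using A_iff by blast
    qed
  qed
  then show ?thesis by (simp add: closed_limpt)
qed

lemma S_unimodal_imp_unimodal:
  assumes "S_unimodal a b f"
  obtains c L where "unimodal a b c f (nderiv_on {a..b} 1 f) L"
proof -
  let ?S = "{a..b}"
  obtain c where c: "c \<in> {a<..<b}" "{x \<in> ?S. nderiv_on ?S 1 f x = 0} = {c}" "\<forall>x\<in>?S. f x \<le> f c"
    using assms by (auto simp: S_unimodal_def)
  have maps: "f ` ?S \<subseteq> ?S" and diff: "\<And>j. j < 3 \<Longrightarrow> nderiv_on ?S j f differentiable_on ?S"
    using assms by (auto simp: S_unimodal_def Ck_on_def)
  have nderiv: "(nderiv_on ?S j f has_real_derivative nderiv_on ?S (Suc j) f x) (at x within ?S)"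
    if "x \<in> ?S" "j < 3" for x j
  proof -
    have "nderiv_on ?S j f differentiable (at x within ?S)"
      using diff that by (auto simp: differentiable_on_def)
    then have "(nderiv_on ?S j f has_vector_derivative
        vector_derivative (nderiv_on ?S j f) (at x within ?S)) (at x within ?S)"
      by (simp add: vector_derivative_works)
    then show ?thesis by (simp add: nderiv_on_def has_real_derivative_iff_has_vector_derivative)
  qed
  have "continuous_on ?S (nderiv_on ?S 2 f)"
    using diff[of 2] by (intro differentiable_imp_continuous_on) auto
  then have "bounded (nderiv_on ?S 2 f ` ?S)"
    by (intro compact_imp_bounded compact_continuous_image) auto
  then obtain L where "\<forall>x\<in>?S. \<bar>nderiv_on ?S 2 f x\<bar> \<le> L"
    unfolding bounded_iff by auto
  then have L: "\<bar>nderiv_on ?S 2 f x\<bar> \<le> L" if "x \<in> ?S" for x using that by blast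
  have "unimodal a b c f (nderiv_on ?S 1 f) L"
  proof
    fix x assume "x \<in> ?S"
    then show "(f has_real_derivative nderiv_on ?S 1 f x) (at x within ?S)"
      using nderiv[of x 0] by (simp add: nderiv_on_def)
  next
    fix x y assume "x \<in> ?S" "y \<in> ?S"
    then show "\<bar>nderiv_on ?S 1 f x - nderiv_on ?S 1 f y\<bar> \<le> L * \<bar>x - y\<bar>"
      using field_differentiable_bound[of ?S "nderiv_on ?S 1 f" "nderiv_on ?S 2 f" L x y] nderiv[of _ 1] L
      by (simp add: numeral_2_eq_2)
  qed (use c maps in auto)
  then show ?thesis by (rule that)
qed

theorem corollary2:
  fixes a b :: real and f :: "real \<Rightarrow> real"
  assumes "S_unimodal a b f"
    and "\<exists>M\<in>nodes {a..b} f. \<exists>N\<in>nodes {a..b} f. M \<noteq> N"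
  shows "\<forall>x\<in>{a..b}. closed (special_alpha_limit {a..b} f x)"
proof -
  obtain c L where "unimodal a b c f (nderiv_on {a..b} 1 f) L"
    using S_unimodal_imp_unimodal[OF assms(1)] .
  then show ?thesis using unimodal.closed_special_alpha_limit by simp
qed

end
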